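(* Let $S\ge 1$ and $N\ge 0$ be fixed integers. For $n\ge 1$ let $|SS_{2N}\rangle=(\hat{\mathcal O}_{SS_2})^N|SG\rangle$ be the $N$-th state of the tower of states of the spin-$S$ AKLT chain with $L=2n$ sites (open boundary conditions, both edge spins in their highest-weight state). For $n$ large, let $\rho_n=\mathrm{Tr}_{\mathcal B}|SS_{2N}\rangle\langle SS_{2N}|/\langle SS_{2N}|SS_{2N}\rangle$ be the normalized reduced density matrix of the subsystem $\mathcal A=\{1,\dots,n\}$, where $\mathcal B=\{n+1,\dots,2n\}$. Then in the limit $n\to\infty$ with $N$ fixed: (i) the spectrum of $\rho_n$ converges to $N+1$ rescaled copies of the $(S+1)$-fold degenerate ground state spectrum. That is, $\rho_n$ has at most $(S+1)(N+1)$ nonzero eigenvalues (counted with multiplicity), and, padded by zeros to exactly $(S+1)(N+1)$ values, they converge as a multiset to the multiset in which, for each $\alpha=0,1,\dots,N$, the value $$\lambda_\alpha=\frac{1}{2^N(S+1)}\binom{N}{\alpha}$$ is included $S+1$ times; (ii) the von Neumann entanglement entropy $-\mathrm{Tr}(\rho_n\log\rho_n)$ converges to $$\mathcal S_N=\log(S+1)+N\log 2-\frac{1}{2^N}\sum_{\alpha=0}^{N}\binom{N}{\alpha}\log\binom{N}{\alpha};$$ (iii) for large $N$, $\mathcal S_N\sim \log(S+1)+\tfrac12\log\left(\tfrac{\pi N}{2}\right)$, i.e. the ratio of the two sides tends to $1$ as $N\to\infty$.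
   Context: Let $S\ge1$ be an integer. Each site of a chain of $L$ sites carries a spin-$S$ with orthonormal basis $|m\rangle$, $m\in\{-S,\dots,S\}$ ($S^z$ eigenbasis), and $S_j^+$ denotes the spin raising operator on site $j$. Spin-$S$ AKLT ground state: let $I=\{-S/2,-S/2+1,\dots,S/2\}$. For $u,v\in I$ define, using Clebsch-Gordan coefficients (standard phase convention) for coupling two spins $S/2$, $$M^{[m]}_{uv}=\langle S,m\,|\,\tfrac S2,u;\tfrac S2,v\rangle \ (\text{zero unless } m=u+v),\qquad \Theta_{uv}=\langle \tfrac S2,u;\tfrac S2,v\,|\,0,0\rangle\ (\text{zero unless }u=-v),$$ and the $(S+1)\times(S+1)$ matrices $A^{[m]}=M^{[m]}\Theta$. The ground state of the open chain with both free edge spin-$S/2$'s having $S^z=+S/2$ is, up to normalization, $$|SG\rangle=\sum_{m_1,\dots,m_L}\left(A^{[m_1]}A^{[m_2]}\cdots A^{[m_L]}\right)_{S/2,\,-S/2}|m_1m_2\cdots m_L\rangle .$$ The tower of states is $|SS_{2N}\rangle=(\hat{\mathcal O}_{SS_2})^N|SG\rangle$ with $\hat{\mathcal O}_{SS_2}=\sum_{j=1}^{L}(-1)^j(S_j^+)^{2S}$. Logarithms are natural. *)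

theory Defs
  imports
    "Jordan_Normal_Form.Schur_Decomposition"
    "Jordan_Normal_Form.Char_Poly"
    "HOL-Computational_Algebra.Fundamental_Theorem_Algebra"
begin

section \<open>Clebsch--Gordan coefficients\<close>

definition fct :: "real \<Rightarrow> real" where
  "fct x = fact (nat \<lfloor>x\<rfloor>)"

text \<open>
  The coefficient \<open>\<langle>J, M | j1, m1; j2, m2\<rangle>\<close> in the Condon--Shortley phase convention, given by
  Racah's closed formula; the alternating sum ranges over all \<open>k\<close> for which every factorial
  has a nonnegative argument. The arguments are meant to be half-integers such that \<open>j1 - m1\<close>,
  \<open>j2 - m2\<close>, \<open>J - M\<close> and \<open>j1 + j2 - J\<close> are integers, so that \<^const>\<open>fct\<close> is only
  applied to integers.
\<close>

definition clebsch_gordan :: "real \<Rightarrow> real \<Rightarrow> real \<Rightarrow> real \<Rightarrow> real \<Rightarrow> real \<Rightarrow> real" where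
  "clebsch_gordan j1 m1 j2 m2 J M =
    (if M = m1 + m2 \<and> \<bar>m1\<bar> \<le> j1 \<and> \<bar>m2\<bar> \<le> j2 \<and> \<bar>M\<bar> \<le> J \<and> \<bar>j1 - j2\<bar> \<le> J \<and> J \<le> j1 + j2
     then
       sqrt ((2 * J + 1) * fct (J + j1 - j2) * fct (J - j1 + j2) * fct (j1 + j2 - J)
              / fct (j1 + j2 + J + 1)) *
       sqrt (fct (J + M) * fct (J - M) * fct (j1 - m1) * fct (j1 + m1)
              * fct (j2 - m2) * fct (j2 + m2)) *
       (\<Sum>k | real k \<le> j1 + j2 - J \<and> real k \<le> j1 - m1 \<and> real k \<le> j2 + m2 \<and>
             0 \<le> J - j2 + m1 + real k \<and> 0 \<le> J - j1 - m2 + real k.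
          (-1) ^ k /
          (fact k * fct (j1 + j2 - J - real k) * fct (j1 - m1 - real k) * fct (j2 + m2 - real k)
            * fct (J - j2 + m1 + real k) * fct (J - j1 - m2 + real k)))
     else 0)"


section \<open>Spin-\<open>S\<close> chains and the AKLT ground state\<close>

text \<open>
  A basis state \<open>|m_1 ... m_L\<rangle>\<close> is the list \<open>[m_1, ..., m_L]\<close>, and a state vector is its
  coefficient function \<open>ms \<mapsto> \<langle>ms|\<psi>\<rangle>\<close>; site \<open>j\<close> is list position \<open>j - 1\<close>. Only
  the values on \<open>set (configs S L)\<close> are meaningful for a chain of \<open>L\<close> sites.
\<close>

type_synonym state = "int list \<Rightarrow> complex"

definition configs :: "nat \<Rightarrow> nat \<Rightarrow> int list list" where
  "configs S L = List.n_lists L [- int S .. int S]"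

text \<open>Matrix position \<open>i \<in> {0..S}\<close> carries the label \<open>-S/2 + i\<close>.\<close>

definition edge_label :: "nat \<Rightarrow> nat \<Rightarrow> real" where
  "edge_label S i = - (real S / 2) + real i"

definition aklt_M :: "nat \<Rightarrow> int \<Rightarrow> complex mat" where
  "aklt_M S m = mat (S + 1) (S + 1) (\<lambda>(i, j). complex_of_real
     (clebsch_gordan (real S / 2) (edge_label S i) (real S / 2) (edge_label S j)
        (real S) (real_of_int m)))"

definition aklt_Theta :: "nat \<Rightarrow> complex mat" where
  "aklt_Theta S = mat (S + 1) (S + 1) (\<lambda>(i, j). complex_of_real
     (clebsch_gordan (real S / 2) (edge_label S i) (real S / 2) (edge_label S j) 0 0))"

definition aklt_A :: "nat \<Rightarrow> int \<Rightarrow> complex mat" where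
  "aklt_A S m = aklt_M S m * aklt_Theta S"

text \<open>Row \<open>S\<close> has label \<open>S/2\<close> and column \<open>0\<close> has label \<open>-S/2\<close>.\<close>

definition aklt_SG :: "nat \<Rightarrow> state" where
  "aklt_SG S ms = foldr (\<lambda>m B. aklt_A S m * B) ms (1\<^sub>m (S + 1)) $$ (S, 0)"


section \<open>The tower of states\<close>

text \<open>
  \<open>S^+ |m\<rangle> = sqrt (S (S + 1) - m (m + 1)) |m + 1\<rangle>\<close>, hence the coefficient at \<open>m\<close> comes
  from the one at \<open>m - 1\<close>; the prefactor vanishes at \<open>m = -S\<close>.
\<close>

definition spin_raise :: "nat \<Rightarrow> nat \<Rightarrow> state \<Rightarrow> state" where
  "spin_raise S j \<psi> = (\<lambda>ms. let m = ms ! (j - 1) in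
     complex_of_real (sqrt (real S * (real S + 1) - real_of_int (m - 1) * real_of_int m))
     * \<psi> (ms[j - 1 := m - 1]))"

definition tower_op :: "nat \<Rightarrow> nat \<Rightarrow> state \<Rightarrow> state" where
  "tower_op S L \<psi> = (\<lambda>ms. \<Sum>j = 1..L. (-1) ^ j * (spin_raise S j ^^ (2 * S)) \<psi> ms)"

definition tower_state :: "nat \<Rightarrow> nat \<Rightarrow> nat \<Rightarrow> state" where
  "tower_state S L N = (tower_op S L ^^ N) (aklt_SG S)"


section \<open>Reduced density matrices and entropy\<close>

definition state_norm2 :: "nat \<Rightarrow> nat \<Rightarrow> state \<Rightarrow> complex" where
  "state_norm2 S L \<psi> = (\<Sum>ms \<in> set (configs S L). \<psi> ms * cnj (\<psi> ms))"

text \<open>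
  For a state of \<open>L\<close> sites, trace out the sites \<open>n + 1, ..., L\<close> and normalize; rows and
  columns are indexed by \<open>configs S n\<close>.
\<close>

definition reduced_density :: "nat \<Rightarrow> nat \<Rightarrow> nat \<Rightarrow> state \<Rightarrow> complex mat" where
  "reduced_density S L n \<psi> =
    (let d = length (configs S n) in
     mat d d (\<lambda>(i, j).
       (\<Sum>b \<in> set (configs S (L - n)).
          \<psi> (configs S n ! i @ b) * cnj (\<psi> (configs S n ! j @ b)))
       / state_norm2 S L \<psi>))"

definition eigenvalues_mset :: "complex mat \<Rightarrow> complex multiset" where
  "eigenvalues_mset A = proots (char_poly A)"

definition nonzero_eigenvalues :: "complex mat \<Rightarrow> complex multiset" where
  "nonzero_eigenvalues A = {# x \<in># eigenvalues_mset A. x \<noteq> 0 #}"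

definition pad_zeros :: "nat \<Rightarrow> complex multiset \<Rightarrow> complex multiset" where
  "pad_zeros k X = X + replicate_mset (k - size X) 0"

definition mset_tendsto ::
    "('b \<Rightarrow> 'a :: topological_space multiset) \<Rightarrow> 'a multiset \<Rightarrow> 'b filter \<Rightarrow> bool" where
  "mset_tendsto X Y F \<longleftrightarrow>
    (\<exists>xs ys. mset ys = Y \<and>
       (\<forall>\<^sub>F n in F. mset (xs n) = X n \<and> length (xs n) = length ys) \<and>
       (\<forall>i < length ys. ((\<lambda>n. xs n ! i) \<longlongrightarrow> ys ! i) F))"

text \<open>
  Functional calculus for a Hermitian matrix: \<open>f(A) = U f(D) U\<^sup>*\<close> for a unitary
  diagonalization \<open>A = U D U\<^sup>*\<close> (\<^const>\<open>similar_mat_wit\<close> includes unitarity of \<open>U\<close> here);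
  the result does not depend on the choice of \<open>U\<close> and \<open>D\<close>.
\<close>

definition hermitian_fun :: "(real \<Rightarrow> real) \<Rightarrow> complex mat \<Rightarrow> complex mat" where
  "hermitian_fun f A = (SOME B. \<exists>U d.
     similar_mat_wit A (mat_diag (dim_row A) (\<lambda>i. complex_of_real (d i))) U (mat_adjoint U) \<and>
     B = U * mat_diag (dim_row A) (\<lambda>i. complex_of_real (f (d i))) * mat_adjoint U)"

definition mat_trace :: "complex mat \<Rightarrow> complex" where
  "mat_trace A = (\<Sum>i < dim_row A. A $$ (i, i))"

text \<open>Since \<open>ln 0 = 0\<close>, zero eigenvalues contribute nothing, as in the convention \<open>0 log 0 = 0\<close>.\<close>

definition von_neumann_entropy :: "complex mat \<Rightarrow> complex" where
  "von_neumann_entropy \<rho> = - mat_trace (\<rho> * hermitian_fun ln \<rho>)"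


section \<open>Limiting values\<close>

definition tower_rho :: "nat \<Rightarrow> nat \<Rightarrow> nat \<Rightarrow> complex mat" where
  "tower_rho S N n = reduced_density S (2 * n) n (tower_state S (2 * n) N)"

definition limit_eigenvalue :: "nat \<Rightarrow> nat \<Rightarrow> nat \<Rightarrow> real" where
  "limit_eigenvalue S N \<alpha> = 1 / (2 ^ N * (real S + 1)) * real (N choose \<alpha>)"

definition limit_entropy :: "nat \<Rightarrow> nat \<Rightarrow> real" where
  "limit_entropy S N = ln (real S + 1) + real N * ln 2
     - 1 / 2 ^ N * (\<Sum>\<alpha> = 0..N. real (N choose \<alpha>) * ln (real (N choose \<alpha>)))"

end

(*
  Since (S^+)^{2S} only turns m = -S into m = S, the N-th power of the tower operator flips N sites, up to
  a constant and signs. In the matrix product state the virtual label left of a site with m = -S is -S/2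
  and left of an unflipped site with m = S it is S/2. Hence the flipped sites can be read off a configuration
  from left to right, and different sets of flipped sites contribute orthogonal vectors.

  Cutting the chain in the middle, the tower state is the sum over k <= N flips on the left and over the
  virtual label t at the cut of |k, t>_A |N - k, t>_B. By conservation of S^z all these vectors are
  orthogonal, so this is the Schmidt decomposition for every n, and the eigenvalues are products of squared
  norms. These norms are powers of a positive matrix proportional to a doubly stochastic one, with k marked
  steps from -S/2 to S/2; they grow like const * kappa^n n^k / k! g^k, independently of t. The product over
  both halves is therefore proportional to 1 / (k! (N - k)!), i.e. to binomial(N, k).

  The limiting entropy is log (S + 1) plus the Shannon entropy of the binomial distribution, which is
  1/2 log N + O(1): from below by the size of the central binomial coefficient, from above by Gibbs'
  inequality against a two-sided geometric distribution of width sqrt N.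
*)
theory Submission
  imports Defs
begin

text \<open>The positive matrix of the overview is \<open>aklt_weight\<close>, the squared moduli of
  the entries of A. It is doubly stochastic after division by \<open>aklt_norm\<close> for two
  reasons: it is symmetric, and a convolution of binomials makes its row sums independent of the
  label. Since the Schmidt vectors have disjoint supports, phases and staggered signs drop out of
  their Gram matrices. The growth n^k / k! is reached through binomial(n+k, k): by Pascal, the
  increments in n of the level k+1 normalizer are normalizers of level k, so Stolz-Cesaro carries
  limits from level k to k+1, while strict positivity contracts deviations from the mean over
  labels. The Schmidt vectors are neither normalized nor known to be nonzero. The density matrix is
  written as P Q, and passing to the diagonal matrix Q P can change only the multiplicity of the
  eigenvalue 0, which filtering and padding absorb. Claim (iii) concerns a ratio with divergent
  denominator, so entropy bounds up to an additive constant suffice; the factor pi / 2 is absorbed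
  in that constant.\<close>

section \<open>Asymptotics of transfer recursions\<close>

text \<open>From some index on, \<open>a - l * b\<close> grows by at most
  \<open>\<epsilon> / 2\<close> times the increment of \<open>b\<close>. Telescoping bounds it by
  \<open>\<epsilon> / 2 * b n\<close> plus a constant, and the constant is swallowed because
  \<open>b\<close> diverges.\<close>

lemma stolz_cesaro:
  fixes a b :: "nat \<Rightarrow> real"
  assumes mono: "strict_mono b" and lim: "filterlim b at_top sequentially"
    and quot: "(\<lambda>n. (a (Suc n) - a n) / (b (Suc n) - b n)) \<longlonglongrightarrow> l"
  shows "(\<lambda>n. a n / b n) \<longlonglongrightarrow> l"
proof -
  have inc: "b (Suc n) - b n > 0" for n
    using mono by (simp add: strict_mono_Suc_iff)
  have "(\<lambda>n. a n / b n - l) \<longlonglongrightarrow> 0"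
  proof (rule LIMSEQ_I)
    fix \<epsilon> :: real assume "0 < \<epsilon>"
    obtain n0 where n0: "\<bar>(a (Suc n) - a n) / (b (Suc n) - b n) - l\<bar> < \<epsilon> / 2" if "n \<ge> n0" for n
      using LIMSEQ_D[OF quot, of "\<epsilon> / 2"] \<open>0 < \<epsilon>\<close> by auto
    define c where "c n = a n - l * b n" for n
    have cstep: "\<bar>c (Suc n) - c n\<bar> \<le> \<epsilon> / 2 * (b (Suc n) - b n)" if "n \<ge> n0" for n
    proof -
      have "c (Suc n) - c n = ((a (Suc n) - a n) / (b (Suc n) - b n) - l) * (b (Suc n) - b n)"
        using inc[of n] by (simp add: c_def field_simps)
      then have "\<bar>c (Suc n) - c n\<bar> = \<bar>(a (Suc n) - a n) / (b (Suc n) - b n) - l\<bar> * (b (Suc n) - b n)"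
        using inc[of n] by (simp add: abs_mult)
      also have "\<dots> \<le> \<epsilon> / 2 * (b (Suc n) - b n)"
        using n0[OF that] inc[of n] by (intro mult_right_mono) auto
      finally show ?thesis .
    qed
    have tele: "\<bar>c n - c n0\<bar> \<le> \<epsilon> / 2 * (b n - b n0)" if "n \<ge> n0" for n
      using that
    proof (induction n rule: dec_induct)
      case (step n)
      have "\<epsilon> / 2 * (b (Suc n) - b n0) = \<epsilon> / 2 * (b n - b n0) + \<epsilon> / 2 * (b (Suc n) - b n)"
        by (simp add: field_simps)
      moreover have "c (Suc n) - c n0 = (c (Suc n) - c n) + (c n - c n0)" by simp
      ultimately show ?case
        using step.IH cstep[OF step.hyps(1)] abs_triangle_ineq[of "c (Suc n) - c n" "c n - c n0"] by linarith
    qed simp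
    \<comment> \<open>Beyond this threshold the initial value \<open>c n0\<close> and the offset
      \<open>b n0\<close> together cost at most a quarter of \<open>\<epsilon> * b n\<close>, which
      leaves room next to the half from telescoping.\<close>
    have ev: "eventually (\<lambda>n. b n > max 1 (4 * (\<bar>c n0\<bar> + \<epsilon> * \<bar>b n0\<bar>) / \<epsilon>)) sequentially"
      by (rule filterlim_at_top_dense[THEN iffD1, OF lim, rule_format])
    then obtain n1 where n1: "b n > max 1 (4 * (\<bar>c n0\<bar> + \<epsilon> * \<bar>b n0\<bar>) / \<epsilon>)" if "n \<ge> n1" for n
      by (auto simp: eventually_sequentially)
    show "\<exists>no. \<forall>n\<ge>no. norm (a n / b n - l - 0) < \<epsilon>"
    proof (intro exI[of _ "max n0 n1"] allI impI)
      fix n assume n: "max n0 n1 \<le> n"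
      then have bn: "b n > 1" "b n > 4 * (\<bar>c n0\<bar> + \<epsilon> * \<bar>b n0\<bar>) / \<epsilon>" using n1[of n] by auto
      have "4 * (\<bar>c n0\<bar> + \<epsilon> * \<bar>b n0\<bar>) < \<epsilon> * b n"
        using bn(2) \<open>0 < \<epsilon>\<close> by (simp add: field_simps)
      moreover have "\<bar>c n\<bar> \<le> \<bar>c n0\<bar> + \<epsilon> / 2 * (b n + \<bar>b n0\<bar>)"
      proof -
        have "\<epsilon> / 2 * (b n - b n0) \<le> \<epsilon> / 2 * (b n + \<bar>b n0\<bar>)"
          using \<open>0 < \<epsilon>\<close> by (intro mult_left_mono) auto
        then show ?thesis using tele[of n] n by linarith
      qed
      ultimately have "\<bar>c n\<bar> < \<epsilon> * b n"
        using mult_nonneg_nonneg[of \<epsilon> "\<bar>b n0\<bar>"] mult_pos_pos[of \<epsilon> "b n"] \<open>0 < \<epsilon>\<close> bn(1) abs_ge_zero[of "c n0"]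
        unfolding distrib_left times_divide_eq_left by linarith
      moreover have "a n / b n - l = c n / b n" using bn(1) by (simp add: c_def field_simps)
      ultimately show "norm (a n / b n - l - 0) < \<epsilon>"
        using bn(1) by (simp add: field_simps)
    qed
  qed
  then show ?thesis by (rule LIM_zero_cancel)
qed

lemma contraction_tendsto_zero:
  fixes e z :: "nat \<Rightarrow> real"
  assumes \<theta>: "0 \<le> \<theta>" "\<theta> < 1" and nonneg: "\<And>n. 0 \<le> e n"
    and step: "\<And>n. e (Suc n) \<le> \<theta> * e n + z n" and z: "z \<longlonglongrightarrow> 0"
  shows "e \<longlonglongrightarrow> 0"
proof (rule LIMSEQ_I)
  fix \<epsilon> :: real assume \<epsilon>: "0 < \<epsilon>"
  \<comment> \<open>For a perturbation of exactly this size, \<open>\<epsilon> / 2\<close> is the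
    fixed point of the affine recursion, so the excess of \<open>e\<close> over
    \<open>\<epsilon> / 2\<close> contracts by \<open>\<theta>\<close>.\<close>
  obtain n0 where n0: "\<bar>z n\<bar> < (1 - \<theta>) * \<epsilon> / 2" if "n \<ge> n0" for n
    using LIMSEQ_D[OF z, of "(1 - \<theta>) * \<epsilon> / 2"] \<epsilon> \<theta> by auto
  have bound: "e (n0 + m) - \<epsilon> / 2 \<le> \<theta> ^ m * e n0" for m
  proof (induction m)
    case (Suc m)
    have "e (n0 + Suc m) - \<epsilon> / 2 \<le> \<theta> * (e (n0 + m) - \<epsilon> / 2)"
      using step[of "n0 + m"] n0[of "n0 + m"] by (simp add: field_simps)
    also have "\<dots> \<le> \<theta> * (\<theta> ^ m * e n0)"
      using Suc \<theta> by (intro mult_left_mono) auto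
    finally show ?case by simp
  qed (use \<epsilon> in simp)
  have "(\<lambda>m. \<theta> ^ m * e n0) \<longlonglongrightarrow> 0"
    using \<theta> by (intro tendsto_mult_left_zero LIMSEQ_power_zero) auto
  then obtain m0 where m0: "\<bar>\<theta> ^ m * e n0\<bar> < \<epsilon> / 2" if "m \<ge> m0" for m
    using LIMSEQ_D[of "\<lambda>m. \<theta> ^ m * e n0" 0 "\<epsilon> / 2"] \<epsilon> by auto
  show "\<exists>no. \<forall>n\<ge>no. norm (e n - 0) < \<epsilon>"
  proof (intro exI[of _ "n0 + m0"] allI impI)
    fix n assume "n0 + m0 \<le> n"
    then obtain m where "n = n0 + m" "m \<ge> m0" by (metis add_le_cancel_left le_iff_add nat_add_left_cancel_le le_trans)
    then show "norm (e n - 0) < \<epsilon>"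
      using bound[of m] m0[of m] nonneg[of n] by auto
  qed
qed

text \<open>Here \<open>v n k s\<close> is the weight of \<open>n\<close>-step paths from
  \<open>s\<close> with \<open>k\<close> marked steps from \<open>a\<close> to \<open>b\<close>.
  Column sums 1 mean that the average over \<open>s\<close> changes only through the marked step;
  row sums 1 and positivity make the deviation from the average decay. So all labels share one
  limit, and the average is a sum of level \<open>k\<close> values, handled by Stolz-Cesaro.\<close>

lemma doubly_stochastic_tower_asymptotics:
  fixes Q :: "nat \<Rightarrow> nat \<Rightarrow> real" and v :: "nat \<Rightarrow> nat \<Rightarrow> nat \<Rightarrow> real"
  assumes Qpos: "\<And>s t. s < d \<Longrightarrow> t < d \<Longrightarrow> 0 < Q s t"
    and rows: "\<And>s. s < d \<Longrightarrow> (\<Sum>t<d. Q s t) = 1"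
    and cols: "\<And>t. t < d \<Longrightarrow> (\<Sum>s<d. Q s t) = 1"
    and v0: "(\<Sum>s<d. v 0 0 s) = 1"
    and rec0: "\<And>n s. s < d \<Longrightarrow> v (Suc n) 0 s = (\<Sum>t<d. Q s t * v n 0 t)"
    and rec: "\<And>n k s. s < d \<Longrightarrow> v (Suc n) (Suc k) s =
        (\<Sum>t<d. Q s t * v n (Suc k) t) + (if s = a then q * v n k b else 0)"
    and a: "a < d" and b: "b < d" and s: "s < d"
  shows "(\<lambda>n. v n k s / real ((n + k) choose k)) \<longlonglongrightarrow> (q / real d) ^ k / real d"
proof -
  have d: "d > 0" using s by auto
  define mean where "mean n k = (\<Sum>s<d. v n k s) / real d" for n k
  define dev where "dev n k = (\<Sum>s<d. \<bar>v n k s - mean n k\<bar>)" for n k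
  define \<delta> where "\<delta> = Min ((\<lambda>(s, t). Q s t) ` ({..<d} \<times> {..<d}))"
  have fin: "finite ((\<lambda>(s, t). Q s t) ` ({..<d} \<times> {..<d}))" by simp
  have \<delta>le: "\<delta> \<le> Q s t" if "s < d" "t < d" for s t
    unfolding \<delta>_def using that by (intro Min_le[OF fin]) auto
  have \<delta>pos: "\<delta> > 0"
    unfolding \<delta>_def using d Qpos by (subst Min_gr_iff[OF fin]) auto
  \<comment> \<open>Rows and columns of \<open>Q\<close> with \<open>\<delta>\<close> subtracted
    from each entry sum to \<open>\<theta>\<close>; it is below 1 by Doeblin's argument, the
    smallest entry being positive.\<close>
  define \<theta> where "\<theta> = 1 - real d * \<delta>"
  have \<theta>1: "\<theta> < 1" using \<delta>pos d by (simp add: \<theta>_def)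
  have "real d * \<delta> \<le> (\<Sum>t<d. Q 0 t)"
    using sum_mono[of "{..<d}" "\<lambda>_. \<delta>" "Q 0"] \<delta>le[OF d] by simp
  then have \<theta>0: "0 \<le> \<theta>" using rows[OF d] by (simp add: \<theta>_def)
  have sumQ: "(\<Sum>s<d. \<Sum>t<d. Q s t * f t) = (\<Sum>t<d. f t)" for f
  proof -
    have "(\<Sum>s<d. \<Sum>t<d. Q s t * f t) = (\<Sum>t<d. (\<Sum>s<d. Q s t) * f t)"
      by (subst sum.swap) (simp add: sum_distrib_right)
    then show ?thesis using cols by simp
  qed
  \<comment> \<open>The marked-step input, set to 0 at level 0 so that both recursions become
    one.\<close>
  define src where "src n k = (case k of 0 \<Rightarrow> 0 | Suc k' \<Rightarrow> q * v n k' b)" for n k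
  have rec': "v (Suc n) k s = (\<Sum>t<d. Q s t * v n k t) + (if s = a then src n k else 0)"
    if "s < d" for n k s
    using that by (cases k) (auto simp: src_def rec0 rec)
  have mean_step: "mean (Suc n) k = mean n k + src n k / real d" for n k
  proof -
    have "(\<Sum>s<d. v (Suc n) k s) = (\<Sum>t<d. v n k t) + src n k"
      using a by (simp add: rec' sum.distrib sumQ)
    then show ?thesis by (simp add: mean_def add_divide_distrib)
  qed
  have dev_step: "dev (Suc n) k \<le> \<theta> * dev n k + 2 * \<bar>src n k\<bar>" for n k
  proof -
    define g where "g t = v n k t - mean n k" for t
    \<comment> \<open>As \<open>g\<close> has mean zero, \<open>Q\<close> acts on it like \<open>Q - \<delta>\<close>, whose \<open>l\<^sup>1\<close> norm is \<open>\<theta> < 1\<close>.\<close>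
    have g0: "(\<Sum>t<d. g t) = 0" using d by (simp add: g_def sum_subtractf mean_def)
    have eq: "v (Suc n) k s - mean (Suc n) k =
        (\<Sum>t<d. (Q s t - \<delta>) * g t) + ((if s = a then src n k else 0) - src n k / real d)" if "s < d" for s
    proof -
      have "(\<Sum>t<d. (Q s t - \<delta>) * g t) = (\<Sum>t<d. Q s t * g t)"
        using g0 by (simp add: left_diff_distrib sum_subtractf flip: sum_distrib_left)
      also have "\<dots> = (\<Sum>t<d. Q s t * v n k t) - mean n k"
        using rows[OF that] by (simp add: g_def right_diff_distrib sum_subtractf flip: sum_distrib_right)
      finally show ?thesis using rec'[OF that, of n k] mean_step[of n k] by simp
    qed
    have "dev (Suc n) k \<le> (\<Sum>s<d. (\<Sum>t<d. (Q s t - \<delta>) * \<bar>g t\<bar>) +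
        ((if s = a then \<bar>src n k\<bar> else 0) + \<bar>src n k\<bar> / real d))"
      unfolding dev_def
    proof (rule sum_mono)
      fix s assume "s \<in> {..<d}"
      then have s: "s < d" by simp
      have 1: "\<bar>\<Sum>t<d. (Q s t - \<delta>) * g t\<bar> \<le> (\<Sum>t<d. (Q s t - \<delta>) * \<bar>g t\<bar>)"
        using \<delta>le[OF s] by (intro order.trans[OF sum_abs] sum_mono) (auto simp: abs_mult)
      have 2: "\<bar>(if s = a then src n k else 0) - src n k / real d\<bar> \<le>
          (if s = a then \<bar>src n k\<bar> else 0) + \<bar>src n k\<bar> / real d"
        using abs_triangle_ineq4[of "if s = a then src n k else 0" "src n k / real d"] by auto
      show "\<bar>v (Suc n) k s - mean (Suc n) k\<bar> \<le> (\<Sum>t<d. (Q s t - \<delta>) * \<bar>g t\<bar>) +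
        ((if s = a then \<bar>src n k\<bar> else 0) + \<bar>src n k\<bar> / real d)"
        unfolding eq[OF s] by (rule order.trans[OF abs_triangle_ineq add_mono[OF 1 2]])
    qed
    \<comment> \<open>The factor 2: the source counts once at \<open>s = a\<close> and once more
      through the shift of the mean, \<open>d\<close> times a \<open>d\<close>-th part.\<close>
    also have "\<dots> = (\<Sum>s<d. \<Sum>t<d. Q s t * \<bar>g t\<bar>) - real d * \<delta> * (\<Sum>t<d. \<bar>g t\<bar>) + 2 * \<bar>src n k\<bar>"
      using a d by (simp add: sum.distrib left_diff_distrib sum_subtractf sum_distrib_left mult.assoc)
    also have "\<dots> = \<theta> * dev n k + 2 * \<bar>src n k\<bar>"
      by (simp add: sumQ dev_def g_def \<theta>_def left_diff_distrib)
    finally show ?thesis .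
  qed
  have bin_pos: "0 < real ((n + k) choose k)" for n k by simp
  have bin_ratio: "real ((n + Suc k) choose Suc k) = real (n + Suc k) / real (Suc k) * real ((n + k) choose k)" for n k
    using Suc_times_binomial_eq[of "n + k" k] by (simp add: field_simps del: binomial_Suc_Suc)
       (metis of_nat_mult of_nat_add of_nat_Suc)
  have bin_step: "real ((Suc n + k) choose k) = real (Suc n + k) / real (Suc n) * real ((n + k) choose k)" for n k
  proof -
    have "Suc n * ((Suc n + k) choose k) = (Suc n + k) * ((n + k) choose k)"
      using Suc_times_binomial_add[of n k] Suc_times_binomial_eq[of "n + k" n]
      by (metis add.commute add_Suc binomial_symmetric le_add1 diff_add_inverse diff_add_inverse2 mult.commute)
    then have "real (Suc n) * real ((Suc n + k) choose k) = real (Suc n + k) * real ((n + k) choose k)"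
      by (metis of_nat_mult)
    then show ?thesis by (simp add: field_simps del: binomial_Suc_Suc)
  qed
  have conv: "(\<lambda>n. v n k s / real ((n + k) choose k)) \<longlonglongrightarrow> l"
    if m: "(\<lambda>n. mean n k / real ((n + k) choose k)) \<longlonglongrightarrow> l"
      and src: "(\<lambda>n. src n k / real ((n + k) choose k)) \<longlonglongrightarrow> 0" and s: "s < d" for k l s
  proof -
    have devlim: "(\<lambda>n. dev n k / real ((n + k) choose k)) \<longlonglongrightarrow> 0"
    proof (rule contraction_tendsto_zero[OF \<theta>0 \<theta>1])
      show "0 \<le> dev n k / real ((n + k) choose k)" for n by (simp add: dev_def sum_nonneg)
      show "(\<lambda>n. 2 * \<bar>src n k / real ((n + k) choose k)\<bar>) \<longlonglongrightarrow> 0"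
        using tendsto_mult_left[OF tendsto_rabs_zero[OF src], of 2] by simp
      show "dev (Suc n) k / real ((Suc n + k) choose k) \<le>
          \<theta> * (dev n k / real ((n + k) choose k)) + 2 * \<bar>src n k / real ((n + k) choose k)\<bar>" for n
      proof -
        \<comment> \<open>The normalizer increases with \<open>n\<close>, so dividing by the older
          one only weakens the bound.\<close>
        have "dev (Suc n) k / real ((Suc n + k) choose k) \<le> dev (Suc n) k / real ((n + k) choose k)"
        proof (rule divide_left_mono)
          show "real ((n + k) choose k) \<le> real ((Suc n + k) choose k)"
            by (cases k) auto
          show "0 \<le> dev (Suc n) k" by (simp add: dev_def sum_nonneg)
        qed (use bin_pos[of n k] bin_pos[of "Suc n" k] in simp)
        also have "\<dots> \<le> (\<theta> * dev n k + 2 * \<bar>src n k\<bar>) / real ((n + k) choose k)"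
          by (rule divide_right_mono[OF dev_step]) simp
        finally show ?thesis by (simp add: add_divide_distrib)
      qed
    qed
    have "(\<lambda>n. v n k s / real ((n + k) choose k) - mean n k / real ((n + k) choose k)) \<longlonglongrightarrow> 0"
    proof (rule tendsto_0_le[OF devlim, where K = 1], rule eventuallyI)
      fix n
      have "\<bar>v n k s - mean n k\<bar> \<le> dev n k"
        unfolding dev_def using s by (intro member_le_sum) auto
      then show "norm (v n k s / real ((n + k) choose k) - mean n k / real ((n + k) choose k))
          \<le> norm (dev n k / real ((n + k) choose k)) * 1"
        by (simp add: divide_right_mono dev_def sum_nonneg flip: diff_divide_distrib)
    qed
    from tendsto_add[OF this m] show ?thesis by simp
  qed
  show ?thesis using s
  proof (induction k arbitrary: s)
    case 0
    have "mean n 0 = 1 / real d" for n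
    proof (induction n)
      case 0 show ?case by (simp add: mean_def v0)
    next
      case (Suc n) then show ?case by (simp add: mean_step src_def)
    qed
    then show ?case using 0 by (intro conv) (simp_all add: src_def)
  next
    case (Suc k)
    have IH: "(\<lambda>n. v n k b / real ((n + k) choose k)) \<longlonglongrightarrow> (q / real d) ^ k / real d"
      using Suc.IH[OF b] .
    show ?case
    proof (rule conv[OF _ _ Suc.prems])
      \<comment> \<open>The source of level \<open>k + 1\<close> has the size of level
        \<open>k\<close>, which is smaller than the own normalizer by the factor
        \<open>(k + 1) / (n + k + 1)\<close>.\<close>
      have "(\<lambda>n. q * (v n k b / real ((n + k) choose k)) * (real (Suc k) / real (n + Suc k)))
          \<longlonglongrightarrow> q * ((q / real d) ^ k / real d) * 0"
      proof (intro tendsto_mult tendsto_const IH)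
        show "(\<lambda>n. real (Suc k) / real (n + Suc k)) \<longlonglongrightarrow> 0"
          using LIMSEQ_ignore_initial_segment[OF lim_const_over_n[of "real (Suc k)"], of "Suc k"] .
      qed
      then show "(\<lambda>n. src n (Suc k) / real ((n + Suc k) choose Suc k)) \<longlonglongrightarrow> 0"
        unfolding bin_ratio src_def by (simp add: mult_ac)
      define bb where "bb n = real ((n + Suc k) choose Suc k)" for n
      have bbstep: "bb (Suc n) - bb n = real ((Suc n + k) choose k)" for n
        by (simp add: bb_def)
      show "(\<lambda>n. mean n (Suc k) / real ((n + Suc k) choose Suc k)) \<longlonglongrightarrow> (q / real d) ^ Suc k / real d"
        unfolding bb_def[symmetric]
      proof (rule stolz_cesaro)
        show "strict_mono bb"
          unfolding strict_mono_Suc_iff using bbstep bin_pos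
          by (metis diff_gt_0_iff_gt)
        have bbge: "real n \<le> bb n" for n
        proof (induction n)
          case (Suc n)
          have "1 \<le> (Suc n + k) choose k"
            by (metis One_nat_def Suc_leI le_add2 zero_less_binomial)
          then have "1 \<le> real ((Suc n + k) choose k)"
            by (metis of_nat_1 of_nat_le_iff)
          with Suc bbstep[of n] show ?case by simp
        qed (simp add: bb_def)
        show "filterlim bb at_top sequentially"
          by (rule filterlim_at_top_mono[OF filterlim_real_sequentially]) (simp add: bbge)
        have 1: "(\<lambda>n. real (Suc n) / real (Suc n + k)) \<longlonglongrightarrow> 1"
        proof -
          have "(\<lambda>n. 1 - real k / real (n + Suc k)) \<longlonglongrightarrow> 1 - 0"
            by (intro tendsto_diff tendsto_const
                LIMSEQ_ignore_initial_segment[OF lim_const_over_n[of "real k"], of "Suc k"])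
          moreover have "1 - real k / real (n + Suc k) = real (Suc n) / real (Suc n + k)" for n
            by (simp add: field_simps)
          ultimately show ?thesis by simp
        qed
        \<comment> \<open>The Stolz quotient compares a source at time \<open>n\<close> with a
          normalizer at time \<open>n + 1\<close>; the last factor corrects this shift and tends to
          1.\<close>
        have "(\<lambda>n. q / real d * (v n k b / real ((n + k) choose k)) * (real (Suc n) / real (Suc n + k)))
            \<longlonglongrightarrow> q / real d * ((q / real d) ^ k / real d) * 1"
          by (intro tendsto_mult tendsto_const IH 1)
        moreover have "q / real d * (v n k b / real ((n + k) choose k)) * (real (Suc n) / real (Suc n + k))
          = (mean (Suc n) (Suc k) - mean n (Suc k)) / (bb (Suc n) - bb n)" for n
          unfolding bbstep bin_step mean_step src_def by (simp add: mult_ac)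
        ultimately show "(\<lambda>n. (mean (Suc n) (Suc k) - mean n (Suc k)) / (bb (Suc n) - bb n))
            \<longlonglongrightarrow> (q / real d) ^ Suc k / real d"
          by simp
      qed
    qed
  qed
qed

section \<open>Entropy of the binomial distribution\<close>

text \<open>The ratio of consecutive central binomials is 2(2n+1)/(n+1), and the weight 2n+1 is
  chosen so that the induction step becomes (2n+1)(2n+3) <= (2n+2)^2.\<close>

lemma central_binomial_square_le:
  "real ((2 * n) choose n) ^ 2 * (2 * real n + 1) \<le> 16 ^ n"
proof (induction n)
  case (Suc n)
  define c where "c = real ((2 * n) choose n)"
  have "(2 * Suc n) choose Suc n = 2 * ((2 * n + 1) choose n)"
    using binomial_symmetric[of n "2 * n + 1"] by simp
  moreover have "Suc n * ((2 * n + 1) choose n) = (2 * n + 1) * ((2 * n) choose n)"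
    using Suc_times_binomial_eq[of "2 * n" n] binomial_symmetric[of n "2 * n + 1"]
    by (simp del: binomial_Suc_Suc)
  ultimately have "Suc n * ((2 * Suc n) choose Suc n) = 2 * (2 * n + 1) * ((2 * n) choose n)"
    by (simp only: mult.left_commute[of "Suc n" 2] mult.assoc)
  from arg_cong[OF this, of real]
  have step: "real (Suc n) * real ((2 * Suc n) choose Suc n) = 2 * (2 * real n + 1) * c"
    by (simp add: c_def algebra_simps del: binomial_Suc_Suc mult_Suc_right)
  have "real (Suc n) ^ 2 * (real ((2 * Suc n) choose Suc n) ^ 2 * (2 * real (Suc n) + 1))
      = (2 * (2 * real n + 1) * c) ^ 2 * (2 * real n + 3)"
    unfolding step[symmetric] by (simp add: power_mult_distrib mult.assoc del: binomial_Suc_Suc mult_Suc_right)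
  also have "\<dots> = 4 * ((2 * real n + 1) * (2 * real n + 3)) * (c ^ 2 * (2 * real n + 1))"
    by (simp add: power2_eq_square algebra_simps)
  also have "\<dots> \<le> 4 * (4 * real (Suc n) ^ 2) * 16 ^ n"
  proof (rule mult_mono)
    show "4 * ((2 * real n + 1) * (2 * real n + 3)) \<le> 4 * (4 * real (Suc n) ^ 2)"
      by (simp add: power2_eq_square algebra_simps)
    show "c ^ 2 * (2 * real n + 1) \<le> 16 ^ n" using Suc by (simp add: c_def)
  qed (auto simp: c_def)
  also have "\<dots> = real (Suc n) ^ 2 * 16 ^ Suc n" by simp
  finally show ?case by (simp only: mult_le_cancel_left_pos zero_less_power of_nat_0_less_iff zero_less_Suc)
qed simp

lemma binomial_square_le: "real (n choose k) ^ 2 * (real n + 1) \<le> 4 ^ n"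
proof -
  have mid: "real (n choose (n div 2)) ^ 2 * (real n + 1) \<le> 4 ^ n"
  proof (cases "even n")
    case True
    then obtain m where m: "n = 2 * m" by blast
    have "(4::real) ^ n = 16 ^ m" unfolding m by (simp add: power_mult)
    then show ?thesis using central_binomial_square_le[of m] unfolding m by simp
  next
    case False
    then obtain m where m: "n = 2 * m + 1" using oddE by blast
    \<comment> \<open>For odd \<open>n\<close> the middle coefficient is half of the next even
      central one.\<close>
    have "(2 * Suc m) choose Suc m = 2 * (n choose m)"
      using binomial_symmetric[of m "2 * m + 1"] m by simp
    then have "(2 * real (n choose m)) ^ 2 * (2 * real (Suc m) + 1) \<le> 16 ^ Suc m"
      using central_binomial_square_le[of "Suc m"] by (metis of_nat_mult of_nat_numeral)
    moreover have "(16::real) ^ Suc m = 4 * 4 ^ n" unfolding m by (simp add: power_mult power_add)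
    moreover have "real (n choose m) ^ 2 * (real n + 1) \<le> real (n choose m) ^ 2 * (2 * real (Suc m) + 1)"
      using m by (intro mult_left_mono) auto
    moreover have "n div 2 = m" using m by simp
    ultimately show ?thesis by (simp add: power_mult_distrib mult_ac)
  qed
  have "real (n choose k) ^ 2 * (real n + 1) \<le> real (n choose (n div 2)) ^ 2 * (real n + 1)"
    by (intro mult_right_mono power_mono) (auto simp: binomial_maximum)
  with mid show ?thesis by linarith
qed

lemma ln_diff_ge:
  fixes x y :: real
  assumes "0 < x" "0 < y"
  shows "x * (ln x - ln y) \<ge> x - y"
proof -
  have "ln (y / x) \<le> y / x - 1" using assms by (intro ln_le_minus_one) simp
  then have "x * ln (y / x) \<le> x * (y / x - 1)" using assms by (intro mult_left_mono) auto
  moreover have "x * (y / x - 1) = y - x" using assms by (simp add: field_simps)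
  moreover have "ln (y / x) = ln y - ln x" using assms by (simp add: ln_div)
  ultimately show ?thesis by (simp add: right_diff_distrib)
qed

text \<open>Nonnegativity of relative entropy. Allowing \<open>g\<close> less mass than
  \<open>p\<close> means that \<open>g\<close> may be normalized by a mere upper bound of its
  sum.\<close>

lemma gibbs_inequality:
  fixes p g :: "'a \<Rightarrow> real"
  assumes "finite A" and p: "\<And>x. x \<in> A \<Longrightarrow> 0 < p x" and g: "\<And>x. x \<in> A \<Longrightarrow> 0 < g x"
    and "(\<Sum>x\<in>A. g x) \<le> (\<Sum>x\<in>A. p x)"
  shows "- (\<Sum>x\<in>A. p x * ln (p x)) \<le> - (\<Sum>x\<in>A. p x * ln (g x))"
proof -
  have "0 \<le> (\<Sum>x\<in>A. p x - g x)" using assms by (simp add: sum_subtractf)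
  also have "\<dots> \<le> (\<Sum>x\<in>A. p x * (ln (p x) - ln (g x)))"
    using p g by (intro sum_mono ln_diff_ge) auto
  finally show ?thesis by (simp add: right_diff_distrib sum_subtractf)
qed

text \<open>\<open>2 * k - n\<close> is the endpoint of a walk with \<open>n\<close> steps of size
  1. By Pascal's rule one more step replaces x^2 by (x-1)^2 + (x+1)^2 = 2 x^2 + 2.\<close>

lemma binomial_variance:
  "(\<Sum>k\<le>n. real (n choose k) * (2 * real k - real n) ^ 2) = 2 ^ n * real n"
proof (induction n)
  case (Suc n)
  have s0: "(\<Sum>k\<le>n. real (n choose k)) = 2 ^ n"
    using choose_row_sum[of n] by (metis of_nat_sum of_nat_power of_nat_numeral)
  have split: "(\<Sum>k\<le>Suc n. real (Suc n choose k) * f k) = (\<Sum>k\<le>n. real (n choose k) * (f k + f (Suc k)))"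
    for f :: "nat \<Rightarrow> real"
  proof -
    have "(\<Sum>k\<le>Suc n. real (Suc n choose k) * f k) =
        f 0 + (\<Sum>k\<le>n. real (n choose k) * f (Suc k)) + (\<Sum>k\<le>n. real (n choose Suc k) * f (Suc k))"
      by (subst sum.atMost_Suc_shift) (simp add: sum.distrib algebra_simps)
    also have "f 0 + (\<Sum>k\<le>n. real (n choose Suc k) * f (Suc k)) = (\<Sum>k\<le>Suc n. real (n choose k) * f k)"
      by (subst sum.atMost_Suc_shift) simp
    then have "f 0 + (\<Sum>k\<le>n. real (n choose k) * f (Suc k)) + (\<Sum>k\<le>n. real (n choose Suc k) * f (Suc k))
      = (\<Sum>k\<le>Suc n. real (n choose k) * f k) + (\<Sum>k\<le>n. real (n choose k) * f (Suc k))" by simp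
    finally show ?thesis by (simp add: sum.distrib algebra_simps)
  qed
  have "(\<Sum>k\<le>Suc n. real (Suc n choose k) * (2 * real k - real (Suc n)) ^ 2) =
      (\<Sum>k\<le>n. real (n choose k) * (2 * (2 * real k - real n) ^ 2 + 2))"
    unfolding split by (intro sum.cong) (auto simp: power2_eq_square algebra_simps)
  also have "\<dots> = 2 * (\<Sum>k\<le>n. real (n choose k) * (2 * real k - real n) ^ 2) + 2 * (\<Sum>k\<le>n. real (n choose k))"
    unfolding sum_distrib_left sum.distrib[symmetric]
    by (intro sum.cong) (auto simp: algebra_simps)
  also have "\<dots> = 2 * (2 ^ n * real n) + 2 * 2 ^ n" unfolding Suc s0 ..
  finally show ?case by (simp add: algebra_simps)
qed simp

text \<open>The Shannon entropy of the fair binomial distribution, in the shape in which it occurs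
  inside \<open>limit_entropy\<close>.\<close>

definition binomial_entropy :: "nat \<Rightarrow> real" where
  "binomial_entropy N = real N * ln 2 - 1 / 2 ^ N * (\<Sum>k = 0..N. real (N choose k) * ln (real (N choose k)))"

lemma binomial_entropy_eq:
  "binomial_entropy N = - (\<Sum>k\<le>N. real (N choose k) / 2 ^ N * ln (real (N choose k) / 2 ^ N))"
proof -
  have s0: "(\<Sum>k\<le>N. real (N choose k)) = 2 ^ N"
    using choose_row_sum[of N] by (metis of_nat_sum of_nat_power of_nat_numeral)
  have "(\<Sum>k\<le>N. real (N choose k) / 2 ^ N * ln (real (N choose k) / 2 ^ N)) =
      (\<Sum>k\<le>N. real (N choose k) * ln (real (N choose k)) / 2 ^ N - real (N choose k) * (real N * ln 2 / 2 ^ N))"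
    by (intro sum.cong) (auto simp: ln_div ln_realpow field_simps)
  also have "\<dots> = 1 / 2 ^ N * (\<Sum>k\<le>N. real (N choose k) * ln (real (N choose k))) - real N * ln 2"
    unfolding sum_subtractf sum_distrib_right[symmetric] s0 by (simp add: sum_divide_distrib)
  finally show ?thesis by (simp add: binomial_entropy_def atMost_atLeast0)
qed

text \<open>No single probability exceeds (N+1)^(-1/2), by \<open>binomial_square_le\<close>, and
  the entropy is the mean of the negative logarithms.\<close>

lemma binomial_entropy_lower: "1 / 2 * ln (real N + 1) \<le> binomial_entropy N"
proof -
  have s0: "(\<Sum>k\<le>N. real (N choose k)) = 2 ^ N"
    using choose_row_sum[of N] by (metis of_nat_sum of_nat_power of_nat_numeral)
  have "1 / 2 * ln (real N + 1) = (\<Sum>k\<le>N. real (N choose k) / 2 ^ N * (1 / 2 * ln (real N + 1)))"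
    unfolding sum_distrib_right[symmetric] sum_divide_distrib[symmetric] s0 by simp
  also have "\<dots> \<le> (\<Sum>k\<le>N. real (N choose k) / 2 ^ N * - ln (real (N choose k) / 2 ^ N))"
  proof (intro sum_mono mult_left_mono)
    fix k assume k: "k \<in> {..N}"
    then have pos: "0 < real (N choose k)" by simp
    have "ln (real (N choose k) ^ 2 * (real N + 1)) \<le> ln (4 ^ N)"
      using binomial_square_le[of N k] pos by (intro ln_mono) auto
    moreover have "ln (4 ^ N) = 2 * real N * ln (2::real)"
      using ln_realpow[of "2::real" 2] by (simp add: ln_realpow)
    moreover have "ln (real (N choose k) ^ 2 * (real N + 1)) = 2 * ln (real (N choose k)) + ln (real N + 1)"
      using pos by (subst ln_mult) (auto simp: ln_realpow)
    moreover have "ln (real (N choose k) / 2 ^ N) = ln (real (N choose k)) - real N * ln 2"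
      using pos by (simp add: ln_div ln_realpow)
    ultimately show "1 / 2 * ln (real N + 1) \<le> - ln (real (N choose k) / 2 ^ N)" by simp
  qed simp
  also have "\<dots> = binomial_entropy N" by (simp add: binomial_entropy_eq sum_negf)
  finally show ?thesis .
qed

lemma two_sided_geometric_sum_le:
  fixes x :: real
  assumes "0 \<le> x" "x < 1" "h \<le> N"
  shows "(\<Sum>k\<le>N. x ^ nat \<bar>int k - int h\<bar>) \<le> 2 / (1 - x)"
proof -
  have geo: "(\<Sum>k<m. x ^ k) \<le> 1 / (1 - x)" for m
    using assms by (subst sum_gp_strict) (auto intro!: divide_right_mono)
  have "{..N} = {..<h} \<union> {h..<Suc N}" using assms by auto
  then have "(\<Sum>k\<le>N. x ^ nat \<bar>int k - int h\<bar>) =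
      (\<Sum>k<h. x ^ nat \<bar>int k - int h\<bar>) + (\<Sum>k=h..<Suc N. x ^ nat \<bar>int k - int h\<bar>)"
    by (simp add: sum.union_disjoint ivl_disj_int)
  \<comment> \<open>The exponent \<open>h - k\<close> is lowered by one so that the reflected sum is
    a full geometric sum starting at power 0.\<close>
  also have "(\<Sum>k<h. x ^ nat \<bar>int k - int h\<bar>) \<le> (\<Sum>k<h. x ^ (h - Suc k))"
    using assms by (intro sum_mono power_decreasing) auto
  also have "(\<Sum>k<h. x ^ (h - Suc k)) = (\<Sum>k<h. x ^ k)"
    by (rule sum.nat_diff_reindex)
  also have "(\<Sum>k=h..<Suc N. x ^ nat \<bar>int k - int h\<bar>) = (\<Sum>k<Suc N - h. x ^ k)"
    by (rule sum.reindex_bij_witness[of _ "\<lambda>k. k + h" "\<lambda>k. k - h"]) (auto simp: nat_diff_distrib)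
  finally show ?thesis using geo[of h] geo[of "Suc N - h"] by (simp add: field_simps)
qed

text \<open>Against a two-sided geometric law, the cross entropy is \<open>ln Z\<close> plus the
  mean distance from the centre in units of \<open>sqrt N\<close>. That mean is bounded through the
  variance, which is of order \<open>N\<close>.\<close>

lemma binomial_entropy_upper:
  assumes N: "N \<ge> 1"
  shows "binomial_entropy N \<le> ln (2 * (sqrt (real N) + 1)) + 2"
proof -
  define r where "r = sqrt (real N)"
  have r1: "r \<ge> 1" using N by (simp add: r_def)
  have r2: "r ^ 2 = real N" by (simp add: r_def)
  define h where "h = N div 2"
  \<comment> \<open>This decay rate gives \<open>ln x = - 1 / r\<close>, and with exp t >= 1 + t the
    two tails together have mass at most \<open>2 * (r + 1)\<close>, the later
    \<open>Z\<close>.\<close>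
  define x where "x = exp (- 1 / r)"
  have x01: "0 < x" "x < 1" using r1 by (auto simp: x_def)
  have "exp (1 / r) \<ge> 1 + 1 / r" by (rule exp_ge_add_one_self)
  then have "x \<le> 1 / (1 + 1 / r)"
    using r1 by (simp add: x_def exp_minus field_simps)
  then have x_le: "1 / (1 - x) \<le> r + 1"
    using r1 x01 by (simp add: field_simps)
  define Z where "Z = 2 * (r + 1)"
  have Z: "Z > 0" using r1 by (simp add: Z_def)
  \<comment> \<open>a sub-probability of width \<open>sqrt N\<close> around \<open>N / 2\<close>\<close>
  define g where "g k = x ^ nat \<bar>int k - int h\<bar> / Z" for k :: nat
  define p where "p k = real (N choose k) / 2 ^ N" for k
  have s0: "(\<Sum>k\<le>N. real (N choose k)) = 2 ^ N"
    using choose_row_sum[of N] by (metis of_nat_sum of_nat_power of_nat_numeral)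
  have p1: "(\<Sum>k\<le>N. p k) = 1" unfolding p_def sum_divide_distrib[symmetric] s0 by simp
  have "(\<Sum>k\<le>N. x ^ nat \<bar>int k - int h\<bar>) \<le> Z"
    using two_sided_geometric_sum_le[of x h N] x01 x_le by (auto simp: h_def Z_def)
  then have "(\<Sum>k\<le>N. g k) \<le> 1"
    unfolding g_def sum_divide_distrib[symmetric] using Z by simp
  then have "binomial_entropy N \<le> - (\<Sum>k\<le>N. p k * ln (g k))"
    unfolding binomial_entropy_eq p_def[symmetric] using x01 Z p1
    by (intro gibbs_inequality) (auto simp: g_def p_def)
  also have "\<dots> = (\<Sum>k\<le>N. p k * - ln (g k))" by (simp add: sum_negf)
  also have "\<dots> \<le> (\<Sum>k\<le>N. p k * (ln Z + 1 + (2 * real k - real N) ^ 2 / real N))"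
  proof (intro sum_mono mult_left_mono)
    fix k
    define y where "y = \<bar>2 * real k - real N\<bar>"
    have "ln (g k) = real (nat \<bar>int k - int h\<bar>) * ln x - ln Z"
      using x01 Z by (simp add: g_def ln_div ln_realpow)
    also have "ln x = - 1 / r" by (simp add: x_def)
    finally have lng: "- ln (g k) = ln Z + real (nat \<bar>int k - int h\<bar>) / r" by simp
    \<comment> \<open>Rounding \<open>N / 2\<close> down to \<open>h\<close> costs at most one half,
      which is the \<open>+ 1\<close> in the next bound.\<close>
    have hN: "2 * int h \<le> int N" "int N \<le> 2 * int h + 1" unfolding h_def by linarith+
    have "2 * real (nat \<bar>int k - int h\<bar>) \<le> y + 1"
    proof -
      have "2 * \<bar>int k - int h\<bar> \<le> \<bar>2 * int k - int N\<bar> + 1" using hN by arith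
      then have "real_of_int (2 * \<bar>int k - int h\<bar>) \<le> real_of_int (\<bar>2 * int k - int N\<bar> + 1)"
        by (simp only: of_int_le_iff)
      then show ?thesis by (simp add: y_def)
    qed
    then have "real (nat \<bar>int k - int h\<bar>) / r \<le> (y + 1) / 2 / r"
      using r1 by (intro divide_right_mono) auto
    \<comment> \<open>The absolute value is traded for a square so that
      \<open>binomial_variance\<close> applies; the square averages to 1, whence the final constant
      2.\<close>
    also have "\<dots> \<le> 1 + (y / r) ^ 2"
    proof -
      have "1 / r \<le> 1" using r1 by simp
      moreover have "y / r \<le> 1 + (y / r) ^ 2"
        using zero_le_power2[of "y / r - 1 / 2"] by (simp add: power2_eq_square algebra_simps)
      moreover have "(u + w) / 2 \<le> 1 + u ^ 2" if "w \<le> 1" "u \<le> 1 + u ^ 2" for u w :: real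
        using that zero_le_power2[of u] unfolding add_divide_distrib by linarith
      ultimately have "(y / r + 1 / r) / 2 \<le> 1 + (y / r) ^ 2" by blast
      then show ?thesis by (simp add: add_divide_distrib)
    qed
    also have "(y / r) ^ 2 = (2 * real k - real N) ^ 2 / real N"
      by (simp add: y_def power_divide r2)
    finally show "- ln (g k) \<le> ln Z + 1 + (2 * real k - real N) ^ 2 / real N"
      unfolding lng by simp
  qed (simp add: p_def)
  also have "\<dots> = (ln Z + 1) * (\<Sum>k\<le>N. p k) + (\<Sum>k\<le>N. real (N choose k) * (2 * real k - real N) ^ 2) / (2 ^ N * real N)"
    unfolding sum_distrib_left sum_divide_distrib sum.distrib[symmetric]
    by (intro sum.cong) (auto simp: p_def algebra_simps add_divide_distrib)
  also have "\<dots> = ln Z + 2" using N by (simp add: p1 binomial_variance)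
  finally show ?thesis by (simp add: Z_def r_def)
qed


lemma quotient_tendsto_one_of_bounded_diff:
  fixes f g :: "'a \<Rightarrow> real"
  assumes g: "filterlim g at_top F" and diff: "eventually (\<lambda>x. \<bar>f x - g x\<bar> \<le> K) F"
  shows "((\<lambda>x. f x / g x) \<longlongrightarrow> 1) F"
proof -
  have pos: "eventually (\<lambda>x. g x > 0) F"
    by (rule filterlim_at_top_dense[THEN iffD1, OF g, rule_format])
  have "((\<lambda>x. K / g x) \<longlongrightarrow> 0) F"
    by (rule tendsto_divide_0[OF tendsto_const filterlim_at_top_imp_at_infinity[OF g]])
  then have "((\<lambda>x. f x / g x - 1) \<longlongrightarrow> 0) F"
  proof (rule tendsto_0_le[where K = 1])
    show "eventually (\<lambda>x. norm (f x / g x - 1) \<le> norm (K / g x) * 1) F"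
      using pos diff
    proof eventually_elim
      case (elim x)
      then have "f x / g x - 1 = (f x - g x) / g x" by (simp add: field_simps)
      then show ?case using elim by (auto simp: intro!: divide_right_mono)
    qed
  qed
  then show ?thesis by (rule LIM_zero_cancel)
qed

text \<open>The entropy lies between \<open>ln N / 2\<close> and \<open>ln N / 2 + ln 4 + 2\<close>,
  and replacing \<open>N\<close> by \<open>pi * N / 2\<close> shifts the comparison function by a
  constant. A bounded difference is harmless as the denominator diverges.\<close>

lemma binomial_entropy_asymptotics:
  fixes c :: real
  shows "(\<lambda>N. (c + binomial_entropy N) / (c + 1 / 2 * ln (pi * real N / 2))) \<longlonglongrightarrow> 1"
proof (rule quotient_tendsto_one_of_bounded_diff)
  have eq: "ln (pi * real N / 2) = ln (pi / 2) + ln (real N)" if "N \<ge> 1" for N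
    using that ln_mult[of "pi / 2" "real N"] by simp
  show "filterlim (\<lambda>N. c + 1 / 2 * ln (pi * real N / 2)) at_top sequentially"
  proof -
    have "filterlim (\<lambda>N. pi / 2 * real N) at_top sequentially"
      by (rule filterlim_tendsto_pos_mult_at_top[OF tendsto_const _ filterlim_real_sequentially]) simp
    from filterlim_compose[OF ln_at_top this]
    have "filterlim (\<lambda>N. 1 / 2 * ln (pi / 2 * real N)) at_top sequentially"
      by (rule filterlim_tendsto_pos_mult_at_top[OF tendsto_const, rotated]) simp
    from filterlim_tendsto_add_at_top[OF tendsto_const this]
    have "filterlim (\<lambda>N. c + 1 / 2 * ln (pi / 2 * real N)) at_top sequentially" .
    then show ?thesis by simp
  qed
  show "eventually (\<lambda>N. \<bar>c + binomial_entropy N - (c + 1 / 2 * ln (pi * real N / 2))\<bar>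
      \<le> ln 4 + 2 + \<bar>ln (pi / 2)\<bar>) sequentially"
    using eventually_ge_at_top[of 1]
  proof eventually_elim
    case (elim N)
    have "sqrt (real N) \<ge> 1" using elim by simp
    then have "ln (2 * (sqrt (real N) + 1)) \<le> ln (4 * sqrt (real N))"
      by (intro ln_mono) (auto intro!: add_nonneg_pos)
    also have "\<dots> = ln 4 + ln (real N) / 2"
      using elim by (simp add: ln_mult ln_sqrt)
    finally have "binomial_entropy N \<le> ln 4 + ln (real N) / 2 + 2"
      using binomial_entropy_upper[OF elim] by simp
    moreover have "ln (real N) / 2 \<le> binomial_entropy N"
    proof -
      have "ln (real N) \<le> ln (real N + 1)" using elim by (intro ln_mono) auto
      then show ?thesis using binomial_entropy_lower[of N] by simp
    qed
    moreover have "0 \<le> ln (4::real)" by simp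
    ultimately show ?case unfolding eq[OF elim] distrib_left
      using abs_ge_self[of "ln (pi / 2)"] abs_ge_minus_self[of "ln (pi / 2)"]
      by (intro abs_leI) linarith+
  qed
qed

section \<open>Hermitian matrices and their spectra\<close>

lemma mat_adjoint_carrier [simp]: "A \<in> carrier_mat n m \<Longrightarrow> mat_adjoint A \<in> carrier_mat m n"
  unfolding mat_adjoint_def by (auto simp: mat_of_rows_def)

lemma mat_adjoint_dim [simp]: "dim_row (mat_adjoint A) = dim_col A" "dim_col (mat_adjoint A) = dim_row A"
  unfolding mat_adjoint_def by (auto simp: mat_of_rows_def)

lemma mat_adjoint_index:
  "i < dim_col A \<Longrightarrow> j < dim_row A \<Longrightarrow> mat_adjoint (A :: complex mat) $$ (i, j) = cnj (A $$ (j, i))"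
  unfolding mat_adjoint_def by (simp add: mat_of_rows_index)

lemma mat_adjoint_adjoint [simp]: "mat_adjoint (mat_adjoint A) = (A :: complex mat)"
  by (rule eq_matI) (auto simp: mat_adjoint_index)

lemma mat_adjoint_mult:
  assumes "A \<in> carrier_mat n m" "B \<in> carrier_mat m k"
  shows "mat_adjoint (A * B) = mat_adjoint B * mat_adjoint (A :: complex mat)"
  using assms by (intro eq_matI) (auto simp: mat_adjoint_index scalar_prod_def cnj_sum mult.commute intro!: sum.cong)

lemma index_mult_mat_sum:
  assumes "A \<in> carrier_mat n m" "B \<in> carrier_mat m k" "i < n" "j < k"
  shows "(A * B) $$ (i, j) = (\<Sum>l<m. A $$ (i, l) * B $$ (l, j))"
  using assms by (auto simp: scalar_prod_def atLeast0LessThan intro!: sum.cong)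

text \<open>An eigenvector exists by the fundamental theorem of algebra. It is completed to a basis
  and orthogonalized, which keeps the first vector; dividing each vector by its length then makes
  the columns orthonormal.\<close>

lemma unitary_with_eigenvector_column:
  fixes A :: "complex mat"
  assumes A: "A \<in> carrier_mat n n" and n: "n > 0"
  obtains W e where "W \<in> carrier_mat n n" "mat_adjoint W * W = 1\<^sub>m n" "A *\<^sub>v col W 0 = e \<cdot>\<^sub>v col W 0"
proof -
  have "degree (char_poly A) = n" using degree_monic_char_poly[OF A] by simp
  then have "\<not> constant (poly (char_poly A))" using n by (simp add: constant_degree)
  then obtain e where "poly (char_poly A) e = 0" using fundamental_theorem_of_algebra by blast
  then have "eigenvalue A e" using eigenvalue_root_char_poly[OF A] by simp
  then obtain v where v: "v \<in> carrier_vec n" "v \<noteq> 0\<^sub>v n" "A *\<^sub>v v = e \<cdot>\<^sub>v v"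
    using A unfolding eigenvalue_def eigenvector_def by auto
  interpret cof_vec_space n "TYPE(complex)" .
  define b where "b = basis_completion v"
  define ws where "ws = gram_schmidt n b"
  from basis_completion[OF v(1,2), folded b_def]
  have b: "distinct b" "\<not> lin_dep (set b)" "set b \<subseteq> carrier_vec n" "hd b = v" "length b = n"
    by auto
  then obtain vs where bv: "b = v # vs" using n by (cases b) auto
  from gram_schmidt_result[OF b(3) b(1) b(2) refl, folded ws_def]
  have ws: "set ws \<subseteq> carrier_vec n" "corthogonal ws" "length ws = n" by (auto simp: b(5))
  from gram_schmidt_hd[OF v(1), of vs, folded bv] have hd: "hd ws = v" unfolding ws_def .
  define nrm where "nrm j = complex_of_real (sqrt (\<Sum>i<n. (cmod (ws ! j $ i)) ^ 2))" for j
  define W where "W = mat n n (\<lambda>(i, j). ws ! j $ i / nrm j)"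
  have W: "W \<in> carrier_mat n n" by (simp add: W_def)
  have wsc: "ws ! j \<in> carrier_vec n" if "j < n" for j using ws that by auto
  have ip: "ws ! j \<bullet>c ws ! k = (\<Sum>i<n. ws ! j $ i * cnj (ws ! k $ i))" if "j < n" "k < n" for j k
    using wsc[OF that(1)] wsc[OF that(2)] by (auto simp: scalar_prod_def atLeast0LessThan intro!: sum.cong)
  have nrm2: "ws ! j \<bullet>c ws ! j = nrm j * nrm j" if "j < n" for j
  proof -
    have "nrm j * nrm j = complex_of_real (\<Sum>i<n. (cmod (ws ! j $ i)) ^ 2)"
      unfolding nrm_def of_real_mult[symmetric] by (simp add: sum_nonneg)
    also have "\<dots> = ws ! j \<bullet>c ws ! j"
      using that by (simp add: ip complex_norm_square del: of_real_power)
    finally show ?thesis ..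
  qed
  have cn: "cnj (nrm j) = nrm j" for j by (simp add: nrm_def)
  have nrm0: "nrm j \<noteq> 0" if "j < n" for j
    using corthogonalD[OF ws(2), of j j] that nrm2[OF that] ws(3) by auto
  have "mat_adjoint W * W = 1\<^sub>m n"
  proof (rule eq_matI)
    fix j k assume "j < dim_row (1\<^sub>m n)" "k < dim_col (1\<^sub>m n)"
    then have jk: "j < n" "k < n" by auto
    have "(mat_adjoint W * W) $$ (j, k) = (\<Sum>i<n. mat_adjoint W $$ (j, i) * W $$ (i, k))"
      using W jk by (intro index_mult_mat_sum[of _ n n _ n]) auto
    also have "\<dots> = (\<Sum>i<n. ws ! k $ i * cnj (ws ! j $ i) / (nrm j * nrm k))"
      using W jk by (intro sum.cong) (auto simp: mat_adjoint_index W_def cn)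
    also have "\<dots> = (ws ! k \<bullet>c ws ! j) / (nrm j * nrm k)"
      using jk by (simp add: ip sum_divide_distrib)
    also have "\<dots> = 1\<^sub>m n $$ (j, k)"
      using jk corthogonalD[OF ws(2), of k j] ws(3) nrm2[of j] nrm0[of j] by auto
    finally show "(mat_adjoint W * W) $$ (j, k) = 1\<^sub>m n $$ (j, k)" .
  qed (use W in auto)
  moreover have "A *\<^sub>v col W 0 = e \<cdot>\<^sub>v col W 0"
  proof -
    have "ws ! 0 = v" using hd ws(3) n by (cases ws) auto
    then have "col W 0 = (1 / nrm 0) \<cdot>\<^sub>v v"
      using n v(1) by (intro eq_vecI) (auto simp: W_def)
    then show ?thesis using v A by (simp add: mult_mat_vec smult_smult_assoc mult.commute)
  qed
  ultimately show ?thesis using that W by blast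
qed

lemma mult_block_diag:
  assumes "A \<in> carrier_mat m m" "B \<in> carrier_mat n n" "C \<in> carrier_mat m m" "D \<in> carrier_mat n n"
  shows "four_block_mat A (0\<^sub>m m n) (0\<^sub>m n m) B * four_block_mat C (0\<^sub>m m n) (0\<^sub>m n m) D =
    four_block_mat (A * C) (0\<^sub>m m n) (0\<^sub>m n m) (B * D)"
proof -
  have "four_block_mat A (0\<^sub>m m n) (0\<^sub>m n m) B * four_block_mat C (0\<^sub>m m n) (0\<^sub>m n m) D =
    four_block_mat (A * C + 0\<^sub>m m n * 0\<^sub>m n m) (A * 0\<^sub>m m n + 0\<^sub>m m n * D)
      (0\<^sub>m n m * C + B * 0\<^sub>m n m) (0\<^sub>m n m * 0\<^sub>m m n + B * D)"
    by (rule mult_four_block_mat) (use assms in auto)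
  also have "\<dots> = four_block_mat (A * C) (0\<^sub>m m n) (0\<^sub>m n m) (B * D)"
    using assms mult_carrier_mat[OF assms(1,3)] mult_carrier_mat[OF assms(2,4)]
    by (intro cong_four_block_mat)
       (simp_all add: left_mult_zero_mat[of D n n] right_mult_zero_mat[of A m m]
         left_mult_zero_mat[of C m m] right_mult_zero_mat[of B n n])
  finally show ?thesis .
qed

text \<open>Deflation: conjugating by a unitary whose first column is an eigenvector clears the
  first column below the diagonal, Hermiticity clears the first row, and the remaining block is
  Hermitian again. This supplies the witness that the choice in \<open>hermitian_fun\<close> relies
  on.\<close>

lemma hermitian_unitary_diagonalization:
  fixes A :: "complex mat"
  assumes "A \<in> carrier_mat n n" "mat_adjoint A = A"
  shows "\<exists>U d. U \<in> carrier_mat n n \<and> mat_adjoint U * U = 1\<^sub>m n \<and>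
    A = U * mat_diag n (\<lambda>i. complex_of_real (d i)) * mat_adjoint U"
  using assms
proof (induction n arbitrary: A)
  case 0
  then show ?case by (intro exI[of _ "1\<^sub>m 0"]) (auto intro!: eq_matI)
next
  case (Suc n)
  note A = Suc.prems(1)
  note assoc = assoc_mult_mat[of _ "Suc n" "Suc n" _ "Suc n" _ "Suc n"]
    mult_carrier_mat[of _ "Suc n" "Suc n" _ "Suc n"]
  obtain W e where W: "W \<in> carrier_mat (Suc n) (Suc n)" and WW: "mat_adjoint W * W = 1\<^sub>m (Suc n)"
    and ev: "A *\<^sub>v col W 0 = e \<cdot>\<^sub>v col W 0"
    using unitary_with_eigenvector_column[OF A] by blast
  have W': "mat_adjoint W \<in> carrier_mat (Suc n) (Suc n)" using W by simp
  have WW': "W * mat_adjoint W = 1\<^sub>m (Suc n)" by (rule mat_mult_left_right_inverse[OF W' W WW])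
  define B where "B = mat_adjoint W * A * W"
  have B: "B \<in> carrier_mat (Suc n) (Suc n)" using A W W' by (simp add: B_def assoc)
  have Bh: "mat_adjoint B = B"
  proof -
    have "mat_adjoint B = mat_adjoint W * (mat_adjoint A * mat_adjoint (mat_adjoint W))"
      using mat_adjoint_mult[OF mult_carrier_mat[OF W' A] W] mat_adjoint_mult[OF W' A]
      by (simp add: B_def)
    then show ?thesis using Suc.prems(2) A W W' by (simp add: B_def assoc)
  qed
  have AB: "A = W * B * mat_adjoint W"
  proof -
    have "W * B * mat_adjoint W = (W * mat_adjoint W) * A * (W * mat_adjoint W)"
      unfolding B_def using A W W' by (simp add: assoc)
    then show ?thesis using A by (simp add: WW')
  qed
  have Bc: "B $$ (i, 0) = (if i = 0 then e else 0)" if i: "i < Suc n" for i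
  proof -
    have "col B 0 = mat_adjoint W *\<^sub>v (A *\<^sub>v col W 0)"
      unfolding B_def assoc_mult_mat[OF W' A W] col_mult2[OF W' mult_carrier_mat[OF A W] zero_less_Suc]
        col_mult2[OF A W zero_less_Suc] ..
    also have "\<dots> = e \<cdot>\<^sub>v (mat_adjoint W *\<^sub>v col W 0)"
      unfolding ev by (rule mult_mat_vec[OF W' col_carrier_vec[OF _ W]]) simp
    also have "mat_adjoint W *\<^sub>v col W 0 = col (1\<^sub>m (Suc n)) 0"
      using col_mult2[OF W' W, of 0] by (simp add: WW)
    finally have "col B 0 $ i = (e \<cdot>\<^sub>v col (1\<^sub>m (Suc n)) 0) $ i" by simp
    then show ?thesis using i B by (auto split: if_splits)
  qed
  have Bherm: "B $$ (i, j) = cnj (B $$ (j, i))" if "i < Suc n" "j < Suc n" for i j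
    by (rule mat_adjoint_index[of i B j, unfolded Bh]) (use B that in auto)
  \<comment> \<open>The eigenvalue is a diagonal entry of a Hermitian matrix, hence real.\<close>
  have e: "e = complex_of_real (Re e)"
    using arg_cong[OF Bherm[of 0 0], of Im] Bc[of 0] by (simp add: complex_eq_iff)
  define C where "C = mat n n (\<lambda>(i, j). B $$ (Suc i, Suc j))"
  have C: "C \<in> carrier_mat n n" by (simp add: C_def)
  have "mat_adjoint C = C"
    by (rule eq_matI) (auto simp: C_def mat_adjoint_index Bherm[symmetric])
  from Suc.IH[OF C this] obtain V d where V: "V \<in> carrier_mat n n" and VV: "mat_adjoint V * V = 1\<^sub>m n"
    and CV: "C = V * mat_diag n (\<lambda>i. complex_of_real (d i)) * mat_adjoint V" by blast
  have V': "mat_adjoint V \<in> carrier_mat n n" using V by simp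
  let ?E = "mat 1 1 (\<lambda>_. e)" and ?z = "0\<^sub>m 1 n" and ?z' = "0\<^sub>m n 1" and ?D = "mat_diag n (\<lambda>i. complex_of_real (d i))"
  define T where "T = four_block_mat (1\<^sub>m 1) ?z ?z' V"
  have T: "T \<in> carrier_mat (Suc n) (Suc n)" unfolding T_def using four_block_carrier_mat[OF one_carrier_mat V, of 1] by simp
  have T': "mat_adjoint T = four_block_mat (1\<^sub>m 1) ?z ?z' (mat_adjoint V)"
    using V unfolding T_def by (intro eq_matI) (auto simp: mat_adjoint_index)
  have TT: "mat_adjoint T * T = 1\<^sub>m (Suc n)"
    unfolding T' unfolding T_def using V V' VV
    by (subst mult_four_block_mat[of _ 1 1 _ n _ n _ _ 1 _ n]) auto
  have D: "?D \<in> carrier_mat n n" by simp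
  have Dblock: "mat_diag (Suc n) (\<lambda>i. complex_of_real (case i of 0 \<Rightarrow> Re e | Suc j \<Rightarrow> d j)) = four_block_mat ?E ?z ?z' ?D"
    using e by (intro eq_matI) (auto simp: mat_diag_def split: nat.splits)
  have "B = four_block_mat ?E ?z ?z' C"
  proof (rule eq_matI)
    fix i j assume "i < dim_row (four_block_mat ?E ?z ?z' C)" "j < dim_col (four_block_mat ?E ?z ?z' C)"
    then have ij: "i < Suc n" "j < Suc n" by (auto simp: C_def)
    show "B $$ (i, j) = four_block_mat ?E ?z ?z' C $$ (i, j)"
    proof (cases "j = 0")
      case True
      then show ?thesis using Bc[OF ij(1)] ij by (simp add: C_def)
    next
      case False
      then have "B $$ (0, j) = 0" using Bc[OF ij(2)] Bherm[of 0 j] ij by simp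
      then show ?thesis using False ij by (cases i; cases j) (simp_all add: C_def)
    qed
  qed (use B C in auto)
  also have "\<dots> = T * four_block_mat ?E ?z ?z' ?D * mat_adjoint T"
  proof -
    have VD: "V * ?D \<in> carrier_mat n n" using V by auto
    have E: "?E \<in> carrier_mat 1 1" by simp
    have "T * four_block_mat ?E ?z ?z' ?D * mat_adjoint T = four_block_mat ?E ?z ?z' C"
      unfolding T' unfolding T_def CV
      by (simp only: mult_block_diag[OF one_carrier_mat V E D] mult_block_diag[OF E VD one_carrier_mat V']
          left_mult_one_mat[OF E] right_mult_one_mat[OF E])
    then show ?thesis ..
  qed
  finally have BT: "B = T * mat_diag (Suc n) (\<lambda>i. complex_of_real (case i of 0 \<Rightarrow> Re e | Suc j \<Rightarrow> d j)) * mat_adjoint T"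
    (is "_ = T * ?F * _") unfolding Dblock .
  have F: "?F \<in> carrier_mat (Suc n) (Suc n)" by simp
  have adj: "mat_adjoint (W * T) = mat_adjoint T * mat_adjoint W"
    by (rule mat_adjoint_mult[OF W T])
  have T'c: "mat_adjoint T \<in> carrier_mat (Suc n) (Suc n)" using T by simp
  have "mat_adjoint (W * T) * (W * T) = mat_adjoint T * ((mat_adjoint W * W) * T)"
    unfolding adj using W W' T T'c by (simp add: assoc)
  also have "\<dots> = 1\<^sub>m (Suc n)" using T TT by (simp add: WW)
  finally have 1: "mat_adjoint (W * T) * (W * T) = 1\<^sub>m (Suc n)" .
  have "(W * T) * ?F * mat_adjoint (W * T) = W * (T * ?F * mat_adjoint T) * mat_adjoint W"
    unfolding adj using W W' T T'c F by (simp add: assoc)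
  then have "A = (W * T) * ?F * mat_adjoint (W * T)" by (simp only: BT[symmetric] AB[symmetric])
  with 1 show ?case using W T by (intro exI[of _ "W * T"] exI) auto
qed

lemma mat_trace_mult_commute:
  assumes "A \<in> carrier_mat n m" "B \<in> carrier_mat m n"
  shows "mat_trace (A * B) = mat_trace (B * A)"
proof -
  have "mat_trace (A * B) = (\<Sum>i<n. \<Sum>l<m. A $$ (i, l) * B $$ (l, i))"
    unfolding mat_trace_def using assms
    by (intro sum.cong) (auto simp: index_mult_mat_sum simp del: index_mult_mat(1))
  also have "\<dots> = (\<Sum>l<m. \<Sum>i<n. B $$ (l, i) * A $$ (i, l))"
    by (subst sum.swap) (simp add: mult.commute)
  also have "\<dots> = mat_trace (B * A)"
    unfolding mat_trace_def using assms
    by (intro sum.cong) (auto simp: index_mult_mat_sum simp del: index_mult_mat(1))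
  finally show ?thesis .
qed

lemma proots_linear_factors: "proots (\<Prod>a\<leftarrow>xs. [:- a, 1:] :: complex poly) = mset xs"
proof (induction xs)
  case (Cons a xs)
  have "(\<Prod>a\<leftarrow>xs. [:- a, 1:] :: complex poly) \<noteq> 0"
    by (auto simp: prod_list_zero_iff)
  then show ?case using Cons by (simp add: proots_mult del: mult_pCons_left)
qed simp

lemma eigenvalues_mset_similar_mat_diag:
  assumes "similar_mat_wit A (mat_diag n d) U V" "dim_row A = n"
  shows "eigenvalues_mset A = mset (map d [0..<n])"
proof -
  have "char_poly A = char_poly (mat_diag n d)"
    using assms by (intro char_poly_similar) (auto simp: similar_mat_def)
  also have "\<dots> = (\<Prod>a\<leftarrow>diag_mat (mat_diag n d). [:- a, 1:])"
    by (rule char_poly_upper_triangular[of _ n]) (auto simp: mat_diag_def)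
  also have "diag_mat (mat_diag n d) = map d [0..<n]"
    by (auto simp: diag_mat_def mat_diag_def)
  finally show ?thesis by (simp only: eigenvalues_mset_def proots_linear_factors)
qed

text \<open>Whichever diagonalization the choice in \<open>hermitian_fun\<close> returns, cyclicity
  of the trace leaves the sum of \<open>d ln d\<close> over its diagonal, and that diagonal is the
  root multiset of the characteristic polynomial.\<close>

lemma von_neumann_entropy_eq_sum_nonzero_eigenvalues:
  assumes A: "A \<in> carrier_mat n n" and herm: "mat_adjoint A = A"
  shows "von_neumann_entropy A = complex_of_real (- (\<Sum>x\<in>#nonzero_eigenvalues A. Re x * ln (Re x)))"
proof -
  have dim: "dim_row A = n" using A by simp
  let ?P = "\<lambda>B. \<exists>U d. similar_mat_wit A (mat_diag (dim_row A) (\<lambda>i. complex_of_real (d i))) U (mat_adjoint U) \<and>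
     B = U * mat_diag (dim_row A) (\<lambda>i. complex_of_real (ln (d i))) * mat_adjoint U"
  have "\<exists>B. ?P B"
  proof -
    obtain U d where U: "U \<in> carrier_mat n n" and UU: "mat_adjoint U * U = 1\<^sub>m n"
      and AU: "A = U * mat_diag n (\<lambda>i. complex_of_real (d i)) * mat_adjoint U"
      using hermitian_unitary_diagonalization[OF A herm] by blast
    have "U * mat_adjoint U = 1\<^sub>m n" using mat_mult_left_right_inverse[OF _ U UU] U by simp
    then have "similar_mat_wit A (mat_diag n (\<lambda>i. complex_of_real (d i))) U (mat_adjoint U)"
      using A U UU AU by (intro similar_mat_witI[of _ _ n]) auto
    then show ?thesis unfolding dim
      by (intro exI[of _ "U * mat_diag n (\<lambda>i. complex_of_real (ln (d i))) * mat_adjoint U"] exI conjI) (assumption, rule refl)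
  qed
  then have "?P (hermitian_fun ln A)" unfolding hermitian_fun_def by (rule someI_ex)
  then obtain U d where sim: "similar_mat_wit A (mat_diag n (\<lambda>i. complex_of_real (d i))) U (mat_adjoint U)"
    and fA: "hermitian_fun ln A = U * mat_diag n (\<lambda>i. complex_of_real (ln (d i))) * mat_adjoint U"
    unfolding dim by blast
  let ?D = "mat_diag n (\<lambda>i. complex_of_real (d i))" and ?L = "mat_diag n (\<lambda>i. complex_of_real (ln (d i)))"
  note w = similar_mat_witD2[OF A sim]
  have c: "U \<in> carrier_mat n n" "mat_adjoint U \<in> carrier_mat n n" "?D \<in> carrier_mat n n" "?L \<in> carrier_mat n n"
    using w by auto
  note assoc = assoc_mult_mat[of _ n n _ n _ n] mult_carrier_mat[of _ n n _ n] left_mult_one_mat[of _ n n] right_mult_one_mat[of _ n n]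
  have "A * hermitian_fun ln A = U * ?D * (mat_adjoint U * U) * ?L * mat_adjoint U"
    unfolding fA by (subst w(3)) (use c in \<open>simp add: assoc\<close>)
  also have "\<dots> = U * (?D * ?L * mat_adjoint U)" using c w(2) by (simp add: assoc del: mat_diag_diag)
  finally have "mat_trace (A * hermitian_fun ln A) = mat_trace (U * (?D * ?L * mat_adjoint U))"
    by (simp only:)
  also have "\<dots> = mat_trace (?D * ?L * mat_adjoint U * U)"
    using c by (intro mat_trace_mult_commute[of U n n]) (simp_all add: assoc del: mat_diag_diag)
  also have "?D * ?L * mat_adjoint U * U = ?D * ?L" using c w(2) by (simp add: assoc del: mat_diag_diag)
  also have "mat_trace (?D * ?L) = complex_of_real (\<Sum>i<n. d i * ln (d i))"
    unfolding mat_diag_diag by (simp add: mat_trace_def mat_diag_def)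
  also have "(\<Sum>i<n. d i * ln (d i)) = (\<Sum>x\<in>#eigenvalues_mset A. Re x * ln (Re x))"
    unfolding eigenvalues_mset_similar_mat_diag[OF sim dim]
    by (simp add: multiset.map_comp comp_def sum_unfold_sum_mset flip: atLeast0LessThan)
  also have "\<dots> = (\<Sum>x\<in>#nonzero_eigenvalues A. Re x * ln (Re x))"
  proof -
    have "(\<Sum>x\<in>#M. f x) = (\<Sum>x\<in>#{#x \<in># M. x \<noteq> 0#}. f x)" if "f 0 = 0" for M and f :: "complex \<Rightarrow> real"
      using that by (induction M) auto
    from this[of "\<lambda>x. Re x * ln (Re x)" "eigenvalues_mset A"] show ?thesis
      unfolding nonzero_eigenvalues_def by simp
  qed
  finally show ?thesis by (simp add: von_neumann_entropy_def)
qed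

section \<open>Spectra of a matrix product and of the reversed product\<close>

lemma char_poly_matrix_mult:
  fixes X Y :: "complex mat"
  assumes X: "X \<in> carrier_mat n m" and Y: "Y \<in> carrier_mat m n"
  shows "char_poly_matrix (X * Y) = [:0, 1:] \<cdot>\<^sub>m 1\<^sub>m n - map_mat (\<lambda>a. [:a:]) X * map_mat (\<lambda>a. [:a:]) Y"
proof -
  have const_sum: "[:\<Sum>l<k. f l:] = (\<Sum>l<k. [:f l:])" for f :: "nat \<Rightarrow> complex" and k
  proof (induction k)
    case (Suc k)
    then show ?case using add_pCons[of "sum f {..<k}" 0 "f k" 0] by simp
  qed simp
  have "(map_mat (\<lambda>a. [:a:]) X * map_mat (\<lambda>a. [:a:]) Y) $$ (i, j) = [:(X * Y) $$ (i, j):]"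
    if "i < n" "j < n" for i j
    using X Y that
    by (simp add: index_mult_mat_sum[OF X Y] index_mult_mat_sum[of _ n m _ n] const_sum mult.commute
        del: index_mult_mat(1))
  then show ?thesis
    unfolding char_poly_matrix_def using X Y by (intro eq_matI) (auto simp del: index_mult_mat(1))
qed

text \<open>Sylvester's identity, from the block matrix \<open>M\<close> with blocks x I, X, Y, I
  over the polynomials. Right multiplication by \<open>R\<close> exposes x I - X Y and gives
  \<open>det M\<close>; left multiplication by \<open>L\<close> exposes x I - Y X at the price of
  \<open>det L\<close>, a power of x.\<close>

lemma char_poly_mult_commute:
  fixes X Y :: "complex mat"
  assumes X: "X \<in> carrier_mat n m" and Y: "Y \<in> carrier_mat m n"
  shows "[:0, 1:] ^ m * char_poly (X * Y) = [:0, 1:] ^ n * char_poly (Y * X)"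
proof -
  let ?x = "[:0, 1:] :: complex poly"
  define PX PY where "PX = map_mat (\<lambda>a. [:a:]) X" and "PY = map_mat (\<lambda>a. [:a:]) Y"
  have P: "PX \<in> carrier_mat n m" "PY \<in> carrier_mat m n" "- PY \<in> carrier_mat m n"
    "PX * PY \<in> carrier_mat n n" "PY * PX \<in> carrier_mat m m"
    using X Y by (auto simp: PX_def PY_def)
  define M where "M = four_block_mat (?x \<cdot>\<^sub>m 1\<^sub>m n) PX PY (1\<^sub>m m)"
  have M: "M \<in> carrier_mat (n + m) (n + m)" unfolding M_def by (intro four_block_carrier_mat) auto
  define L R where "L = four_block_mat (1\<^sub>m n) (0\<^sub>m n m) (- PY) (?x \<cdot>\<^sub>m 1\<^sub>m m)"
    and "R = four_block_mat (1\<^sub>m n) (0\<^sub>m n m) (- PY) (1\<^sub>m m)"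
  have LR: "L \<in> carrier_mat (n + m) (n + m)" "R \<in> carrier_mat (n + m) (n + m)"
    unfolding L_def R_def by (intro four_block_carrier_mat; auto)+
  have detL: "det L = ?x ^ m"
    unfolding L_def using P by (subst det_four_block_mat_upper_right_zero[of _ n _ m]) (auto simp: det_smult)
  have detR: "det R = 1"
    unfolding R_def using P by (subst det_four_block_mat_upper_right_zero[of _ n _ m]) auto
  have "M * R = four_block_mat (?x \<cdot>\<^sub>m 1\<^sub>m n * 1\<^sub>m n + PX * - PY) (?x \<cdot>\<^sub>m 1\<^sub>m n * 0\<^sub>m n m + PX * 1\<^sub>m m)
      (PY * 1\<^sub>m n + 1\<^sub>m m * - PY) (PY * 0\<^sub>m n m + 1\<^sub>m m * 1\<^sub>m m)"
    unfolding M_def R_def by (rule mult_four_block_mat) (use P in auto)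
  also have "\<dots> = four_block_mat (?x \<cdot>\<^sub>m 1\<^sub>m n - PX * PY) PX (0\<^sub>m m n) (1\<^sub>m m)"
    by (rule cong_four_block_mat) (use P in \<open>auto intro!: eq_matI\<close>)
  finally have "det (M * R) = det (?x \<cdot>\<^sub>m 1\<^sub>m n - PX * PY)"
    using P by (simp only:, subst det_four_block_mat_lower_left_zero[of _ n _ m]) auto
  then have detM: "det M = char_poly (X * Y)"
    by (simp add: det_mult[OF M LR(2)] detR char_poly_def char_poly_matrix_mult[OF X Y] PX_def PY_def)
  have "L * M = four_block_mat (1\<^sub>m n * (?x \<cdot>\<^sub>m 1\<^sub>m n) + 0\<^sub>m n m * PY) (1\<^sub>m n * PX + 0\<^sub>m n m * 1\<^sub>m m)
      (- PY * (?x \<cdot>\<^sub>m 1\<^sub>m n) + (?x \<cdot>\<^sub>m 1\<^sub>m m) * PY) (- PY * PX + (?x \<cdot>\<^sub>m 1\<^sub>m m) * 1\<^sub>m m)"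
    unfolding M_def L_def by (rule mult_four_block_mat) (use P in auto)
  also have "\<dots> = four_block_mat (?x \<cdot>\<^sub>m 1\<^sub>m n) PX (0\<^sub>m m n) (?x \<cdot>\<^sub>m 1\<^sub>m m - PY * PX)"
    by (rule cong_four_block_mat) (use P in \<open>auto intro!: eq_matI\<close>)
  finally have "det (L * M) = ?x ^ n * char_poly (Y * X)"
    using P by (simp only:, subst det_four_block_mat_lower_left_zero[of _ n _ m])
      (auto simp: det_smult char_poly_def char_poly_matrix_mult[OF Y X] PX_def PY_def)
  then show ?thesis by (simp add: det_mult[OF LR(1) M] detL detM)
qed

section \<open>Clebsch--Gordan weights\<close>

lemma fct_of_nat [simp]: "fct (real n) = fact n"
  by (simp add: fct_def)

lemma fct_0 [simp]: "fct 0 = 1"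
  by (simp add: fct_def)

lemma abs_edge_label_le: "i \<le> S \<Longrightarrow> \<bar>edge_label S i\<bar> \<le> real S / 2"
  unfolding edge_label_def by (rule abs_leI) auto

text \<open>For maximal total spin the third triangle factor is 0!, which leaves only
  \<open>k = 0\<close> in Racah's sum. Squaring removes the roots, and the factorials regroup into
  three binomials.\<close>

lemma clebsch_gordan_max_spin:
  assumes "i \<le> S" "j \<le> S"
  shows "(clebsch_gordan (real S / 2) (edge_label S i) (real S / 2) (edge_label S j) (real S) (real_of_int m))\<^sup>2 =
    (if m = int i + int j - int S then real (S choose i) * real (S choose j) / real ((2 * S) choose (i + j)) else 0)"
proof (cases "m = int i + int j - int S")
  case True
  define a b where "a = edge_label S i" and "b = edge_label S j"
  have arg: "real S + real S / 2 - real S / 2 = real S" "real S - real S / 2 + real S / 2 = real S"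
    "real S / 2 + real S / 2 - real S = real 0" "real S / 2 + real S / 2 + real S + 1 = real (2 * S + 1)"
    "real S + real_of_int m = real (i + j)" "real S - real_of_int m = real (2 * S - (i + j))"
    "real S / 2 - a = real (S - i)" "real S / 2 + a = real i"
    "real S / 2 - b = real (S - j)" "real S / 2 + b = real j"
    and arg': "real S - real S / 2 + a = real i" "real S - real S / 2 - b = real (S - j)"
    using assms True by (auto simp: a_def b_def edge_label_def of_nat_diff)
  have cond: "real_of_int m = a + b \<and> \<bar>a\<bar> \<le> real S / 2 \<and> \<bar>b\<bar> \<le> real S / 2 \<and> \<bar>real_of_int m\<bar> \<le> real S \<and>
      \<bar>real S / 2 - real S / 2\<bar> \<le> real S \<and> real S \<le> real S / 2 + real S / 2"
  proof (intro conjI)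
    show m: "real_of_int m = a + b" using True by (simp add: a_def b_def edge_label_def)
    show ab: "\<bar>a\<bar> \<le> real S / 2" "\<bar>b\<bar> \<le> real S / 2"
      unfolding a_def b_def by (rule abs_edge_label_le, rule assms)+
    show "\<bar>real_of_int m\<bar> \<le> real S" using ab abs_triangle_ineq[of a b] unfolding m by linarith
  qed simp_all
  have ks: "{k. real k \<le> real 0 \<and> real k \<le> real (S - i) \<and> real k \<le> real j \<and>
      0 \<le> real i + real k \<and> 0 \<le> real (S - j) + real k} = {0}" by auto
  have cg: "clebsch_gordan (real S / 2) a (real S / 2) b (real S) (real_of_int m) =
      sqrt ((2 * real S + 1) * fact S * fact S * fact 0 / fact (2 * S + 1)) *
      sqrt (fact (i + j) * fact (2 * S - (i + j)) * fact (S - i) * fact i * fact (S - j) * fact j) *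
      (1 / (fact (S - i) * fact j * fact i * fact (S - j)))"
    unfolding clebsch_gordan_def if_P[OF cond] arg arg' ks fct_of_nat by simp
  have "(clebsch_gordan (real S / 2) a (real S / 2) b (real S) (real_of_int m))\<^sup>2 =
      ((2 * real S + 1) * fact S * fact S / fact (2 * S + 1)) *
      (fact (i + j) * fact (2 * S - (i + j)) * fact (S - i) * fact i * fact (S - j) * fact j) *
      (1 / (fact (S - i) * fact j * fact i * fact (S - j)))\<^sup>2"
    unfolding cg power_mult_distrib by simp
  also have "\<dots> = real (S choose i) * real (S choose j) / real ((2 * S) choose (i + j))"
  proof -
    have "real (S choose i) = fact S / (fact i * fact (S - i))" "real (S choose j) = fact S / (fact j * fact (S - j))"
      "real ((2 * S) choose (i + j)) = fact (2 * S) / (fact (i + j) * fact (2 * S - (i + j)))"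
      using assms by (auto intro!: binomial_fact)
    moreover have "fact (2 * S + 1) = (2 * real S + 1) * fact (2 * S)" by simp
    moreover have "2 * real S + 1 \<noteq> 0" by linarith
    ultimately show ?thesis
      by (simp only: power2_eq_square) (simp add: divide_simps del: fact_Suc)
  qed
  finally show ?thesis using True by (simp add: a_def b_def)
next
  case False
  then have "real_of_int m \<noteq> edge_label S i + edge_label S j"
  proof (rule contrapos_nn)
    assume "real_of_int m = edge_label S i + edge_label S j"
    then have "real_of_int m = real_of_int (int i + int j - int S)" by (simp add: edge_label_def)
    then show "m = int i + int j - int S" by linarith
  qed
  then show ?thesis using False by (simp add: clebsch_gordan_def)
qed

text \<open>For total spin 0 the constraints \<open>k \<le> j\<close> and \<open>k \<ge> j\<close>
  leave a single term. Its sign disappears in the square, so the two spins are paired with uniform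
  weight.\<close>

lemma clebsch_gordan_singlet:
  assumes "i \<le> S" "j \<le> S"
  shows "(clebsch_gordan (real S / 2) (edge_label S i) (real S / 2) (edge_label S j) 0 0)\<^sup>2 =
    (if i + j = S then 1 / (real S + 1) else 0)"
proof (cases "i + j = S")
  case True
  define a b where "a = edge_label S i" and "b = edge_label S j"
  have arg: "0 + real S / 2 - real S / 2 = real 0" "0 - real S / 2 + real S / 2 = real 0"
    "real S / 2 + real S / 2 - 0 = real S" "real S / 2 + real S / 2 + 0 + 1 = real (S + 1)"
    "real S / 2 - a = real j" "real S / 2 + a = real i"
    "real S / 2 - b = real i" "real S / 2 + b = real j" "0 - real S / 2 + a = - real j"
    "0 - real S / 2 - b = - real j" "(0::real) + 0 = real 0" "(0::real) - 0 = real 0"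
    using True by (auto simp: a_def b_def edge_label_def)
  have cond: "0 = a + b \<and> \<bar>a\<bar> \<le> real S / 2 \<and> \<bar>b\<bar> \<le> real S / 2 \<and> \<bar>0\<bar> \<le> (0::real) \<and>
      \<bar>real S / 2 - real S / 2\<bar> \<le> 0 \<and> 0 \<le> real S / 2 + real S / 2"
  proof (intro conjI)
    show "0 = a + b" using True by (auto simp: a_def b_def edge_label_def)
    show "\<bar>a\<bar> \<le> real S / 2" "\<bar>b\<bar> \<le> real S / 2"
      unfolding a_def b_def by (rule abs_edge_label_le, rule assms)+
  qed simp_all
  have ks: "{k. real k \<le> real S \<and> real k \<le> real j \<and> real k \<le> real j \<and>
      0 \<le> - real j + real k \<and> 0 \<le> - real j + real k} = {j}" using True by auto
  have sj: "real S - real j = real i" using True by auto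
  have cg: "clebsch_gordan (real S / 2) a (real S / 2) b 0 0 =
      sqrt (fact S / fact (S + 1)) * sqrt (fact j * fact i * fact i * fact j) * ((-1) ^ j / (fact j * fact i))"
    unfolding clebsch_gordan_def if_P[OF cond] arg ks fct_of_nat
    by (simp add: sj del: fact_Suc)
  have "(clebsch_gordan (real S / 2) a (real S / 2) b 0 0)\<^sup>2 =
      fact S / fact (S + 1) * (fact j * fact i * fact i * fact j) * ((-1) ^ j / (fact j * fact i))\<^sup>2"
    unfolding cg power_mult_distrib by (simp del: fact_Suc)
  also have "\<dots> = 1 / (real S + 1)"
  proof -
    have "((-1) ^ j * (-1) ^ j :: real) = 1" by (simp flip: power_mult_distrib)
    moreover have "fact (S + 1) = (real S + 1) * fact S" by simp
    moreover have "real S + 1 \<noteq> 0" by linarith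
    ultimately show ?thesis by (simp only: power2_eq_square times_divide_times_eq) (simp add: divide_simps del: fact_Suc)
  qed
  finally show ?thesis using True by (simp add: a_def b_def)
next
  case False
  then have "0 \<noteq> edge_label S i + edge_label S j"
    by (auto simp: edge_label_def)
  then show ?thesis using False by (simp add: clebsch_gordan_def)
qed

text \<open>The squared modulus of the only nonzero A-entry between labels \<open>s\<close> and
  \<open>t\<close>. The index \<open>S - t\<close> comes from \<open>Theta\<close>, which pairs
  opposite labels, and the last division from its singlet weight.\<close>

definition aklt_weight :: "nat \<Rightarrow> nat \<Rightarrow> nat \<Rightarrow> real" where
  "aklt_weight S s t = real (S choose s) * real (S choose t) / real ((2 * S) choose (s + (S - t))) / (real S + 1)"

lemma aklt_A_norm:
  assumes "s \<le> S" "t \<le> S"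
  shows "(cmod (aklt_A S m $$ (s, t)))\<^sup>2 = (if m = int s - int t then aklt_weight S s t else 0)"
proof -
  let ?M = "\<lambda>w. clebsch_gordan (real S / 2) (edge_label S s) (real S / 2) (edge_label S w) (real S) (real_of_int m)"
  let ?T = "\<lambda>w. clebsch_gordan (real S / 2) (edge_label S w) (real S / 2) (edge_label S t) 0 0"
  have zero: "?T w = 0" if "w \<le> S" "w \<noteq> S - t" for w
    using clebsch_gordan_singlet[of w S t] that assms by (cases "w + t = S") auto
  have "aklt_A S m $$ (s, t) = (\<Sum>w\<in>{0..<S + 1}. complex_of_real (?M w) * complex_of_real (?T w))"
    using assms by (simp add: aklt_A_def aklt_M_def aklt_Theta_def scalar_prod_def)
  also have "\<dots> = (\<Sum>w\<in>{S - t}. complex_of_real (?M w) * complex_of_real (?T w))"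
    using zero by (intro sum.mono_neutral_right) auto
  finally have "(cmod (aklt_A S m $$ (s, t)))\<^sup>2 = (?M (S - t))\<^sup>2 * (?T (S - t))\<^sup>2"
    by (simp add: norm_mult power_mult_distrib)
  also have "\<dots> = (if m = int s - int t then aklt_weight S s t else 0)"
    using assms clebsch_gordan_singlet[of "S - t" S t] clebsch_gordan_max_spin[of s S "S - t" m]
    by (auto simp: aklt_weight_def of_nat_diff binomial_symmetric[of t S])
  finally show ?thesis .
qed

lemma aklt_A_eq_0:
  assumes "s \<le> S" "t \<le> S" "m \<noteq> int s - int t"
  shows "aklt_A S m $$ (s, t) = 0"
  using aklt_A_norm[OF assms(1,2), of m] assms(3) by simp

lemma aklt_weight_pos: "s \<le> S \<Longrightarrow> t \<le> S \<Longrightarrow> 0 < aklt_weight S s t"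
  by (auto simp: aklt_weight_def intro!: divide_pos_pos mult_pos_pos)

text \<open>Complementing the lower index in the denominator swaps the two labels. Symmetry turns
  the row sums below into column sums.\<close>

lemma aklt_weight_sym:
  assumes "s \<le> S" "t \<le> S"
  shows "aklt_weight S s t = aklt_weight S t s"
proof -
  have "(2 * S) choose (s + (S - t)) = (2 * S) choose (2 * S - (s + (S - t)))"
    using assms by (intro binomial_symmetric) auto
  also have "2 * S - (s + (S - t)) = t + (S - s)" using assms by auto
  finally show ?thesis by (simp add: aklt_weight_def mult.commute)
qed

text \<open>Vandermonde's convolution for negative exponents: the coefficient of x^n in (1-x)^(-a-1)
  (1-x)^(-b-1).\<close>

lemma sum_choose_times_choose:
  "(\<Sum>j\<le>n. ((a + j) choose j) * ((b + (n - j)) choose (n - j))) = (a + b + n + 1) choose n"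
proof (induction b arbitrary: n)
  case 0
  then show ?case using sum_choose_lower[of a n] by simp
next
  case (Suc b)
  show ?case
  proof (induction n)
    case (Suc n)
    have "(\<Sum>j\<le>Suc n. ((a + j) choose j) * ((Suc b + (Suc n - j)) choose (Suc n - j))) =
        (\<Sum>j\<le>n. ((a + j) choose j) * ((Suc b + (n - j)) choose (n - j)) +
           ((a + j) choose j) * ((b + (Suc n - j)) choose (Suc n - j))) + ((a + Suc n) choose Suc n)"
      by (auto simp: Suc_diff_le distrib_left intro!: sum.cong)
    also have "\<dots> = (\<Sum>j\<le>n. ((a + j) choose j) * ((Suc b + (n - j)) choose (n - j))) +
        (\<Sum>j\<le>Suc n. ((a + j) choose j) * ((b + (Suc n - j)) choose (Suc n - j)))"
      by (simp add: sum.distrib del: binomial_Suc_Suc)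
    also have "\<dots> = ((a + Suc b + n + 1) choose n) + ((a + b + Suc n + 1) choose Suc n)"
      unfolding Suc.IH \<open>\<And>n. (\<Sum>j\<le>n. ((a + j) choose j) * ((b + (n - j)) choose (n - j))) = (a + b + n + 1) choose n\<close> ..
    finally show ?case by simp
  qed simp
qed

text \<open>The common row sum of \<open>aklt_weight\<close>, hence the Perron eigenvalue of the
  transfer matrix; it simplifies to (2S+1)/(S+1)^2.\<close>

definition aklt_norm :: "nat \<Rightarrow> real" where
  "aklt_norm S = real ((2 * S + 1) choose S) / real ((2 * S) choose S) / (real S + 1)"

lemma aklt_norm_pos: "0 < aklt_norm S"
  by (auto simp: aklt_norm_def intro!: divide_pos_pos)

text \<open>After reversing the index, the factorials regroup into a convolution of
  \<open>s + j\<close> over \<open>j\<close> with its complement. The convolution sees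
  \<open>s\<close> only through \<open>s + (S - s) = S\<close>, so every row has the same
  sum.\<close>

lemma aklt_weight_row_sum:
  assumes s: "s \<le> S"
  shows "(\<Sum>t\<le>S. aklt_weight S s t) = aklt_norm S"
proof -
  have summand: "real (S choose s) * real (S choose j) / real ((2 * S) choose (s + j)) =
      real (((s + j) choose j) * (((S - s) + (S - j)) choose (S - j))) / real ((2 * S) choose S)"
    if j: "j \<le> S" for j
  proof -
    have "2 * S - (s + j) = (S - s) + (S - j)" using s j by auto
    then have b: "real ((2 * S) choose (s + j)) = fact (2 * S) / (fact (s + j) * fact ((S - s) + (S - j)))"
      using s j binomial_fact[of "s + j" "2 * S", where 'a = real] by simp
    have "real (S choose s) = fact S / (fact s * fact (S - s))" "real (S choose j) = fact S / (fact j * fact (S - j))"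
      "real ((2 * S) choose S) = fact (2 * S) / (fact S * fact S)"
      "real ((s + j) choose j) = fact (s + j) / (fact j * fact s)"
      "real (((S - s) + (S - j)) choose (S - j)) = fact ((S - s) + (S - j)) / (fact (S - j) * fact (S - s))"
      using s j binomial_fact[of s S, where 'a = real] binomial_fact[of j S, where 'a = real]
        binomial_fact[of S "2 * S", where 'a = real] binomial_fact[of j "s + j", where 'a = real]
        binomial_fact[of "S - j" "(S - s) + (S - j)", where 'a = real] by (simp_all add: mult_2)
    then show ?thesis by (simp only: of_nat_mult b) (simp add: divide_simps)
  qed
  have "(\<Sum>t\<le>S. aklt_weight S s t) =
      (\<Sum>j\<le>S. real (S choose s) * real (S choose j) / real ((2 * S) choose (s + j)) / (real S + 1))"
    unfolding aklt_weight_def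
    by (rule sum.reindex_bij_witness[of _ "\<lambda>j. S - j" "\<lambda>j. S - j"]) (auto simp: binomial_symmetric[symmetric])
  also have "\<dots> = (\<Sum>j\<le>S. real (((s + j) choose j) * (((S - s) + (S - j)) choose (S - j))) / real ((2 * S) choose S) / (real S + 1))"
    using summand by (intro sum.cong) auto
  also have "\<dots> = real (\<Sum>j\<le>S. ((s + j) choose j) * (((S - s) + (S - j)) choose (S - j))) / real ((2 * S) choose S) / (real S + 1)"
    by (simp add: sum_divide_distrib)
  also have "\<dots> = aklt_norm S"
    unfolding sum_choose_times_choose using s by (simp add: aklt_norm_def mult_2)
  finally show ?thesis .
qed

section \<open>Amplitudes with flipped sites\<close>

text \<open>
  The amplitude of reading \<open>ms\<close> from virtual label \<open>s\<close> to \<open>e\<close> with exactly \<open>k\<close> flipped sites: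
  a letter \<open>S\<close> is either genuine or comes from \<open>-S\<close>; \<open>\<sigma>\<close> is the staggered sign of the first site.
\<close>

fun flip_amp :: "nat \<Rightarrow> complex \<Rightarrow> nat \<Rightarrow> nat \<Rightarrow> int list \<Rightarrow> nat \<Rightarrow> complex" where
  "flip_amp S \<sigma> k s [] e = (if k = 0 \<and> s = e then 1 else 0)"
| "flip_amp S \<sigma> k s (m # ms) e =
    (\<Sum>t\<le>S. aklt_A S m $$ (s, t) * flip_amp S (- \<sigma>) k t ms e) +
    (if m = int S \<and> k > 0
     then \<sigma> * (\<Sum>t\<le>S. aklt_A S (- int S) $$ (s, t) * flip_amp S (- \<sigma>) (k - 1) t ms e) else 0)"

lemma aklt_A_carrier: "aklt_A S m \<in> carrier_mat (S + 1) (S + 1)"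
  unfolding aklt_A_def aklt_M_def aklt_Theta_def by (rule mult_carrier_mat) auto

lemma foldr_aklt_A_eq_flip_amp:
  assumes "s \<le> S" "e \<le> S"
  shows "foldr (\<lambda>m B. aklt_A S m * B) ms (1\<^sub>m (S + 1)) $$ (s, e) = flip_amp S \<sigma> 0 s ms e"
  using assms(1)
proof (induction ms arbitrary: s \<sigma>)
  case (Cons m ms)
  let ?B = "foldr (\<lambda>m B. aklt_A S m * B) ms (1\<^sub>m (S + 1))"
  have "?B \<in> carrier_mat (S + 1) (S + 1)"
  proof (induction ms)
    case (Cons m ms)
    then show ?case using mult_carrier_mat[OF aklt_A_carrier Cons] by simp
  qed simp
  then have "(aklt_A S m * ?B) $$ (s, e) = (\<Sum>t\<in>{0..<S + 1}. aklt_A S m $$ (s, t) * ?B $$ (t, e))"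
    using Cons.prems assms(2) aklt_A_carrier[of S m] by (auto simp: scalar_prod_def intro!: sum.cong)
  also have "\<dots> = (\<Sum>t\<le>S. aklt_A S m $$ (s, t) * flip_amp S (- \<sigma>) 0 t ms e)"
    using Cons.IH by (intro sum.cong) auto
  finally show ?case by simp
qed (use assms(2) in auto)

section \<open>The tower operator as a sum of flips\<close>

text \<open>The staggered operator without its ladder constant, acting on coefficients: a letter
  \<open>S\<close> is pulled back to \<open>-S\<close>. The sign of the first site is a parameter
  because passing to the tail reverses it.\<close>

definition alt_flip :: "nat \<Rightarrow> complex \<Rightarrow> state \<Rightarrow> state" where
  "alt_flip S \<sigma> \<psi> ms = (\<Sum>j<length ms. if ms ! j = int S then \<sigma> * (-1) ^ j * \<psi> (ms[j := - int S]) else 0)"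

lemma alt_flip_Cons:
  "alt_flip S \<sigma> \<psi> (m # ms) = (if m = int S then \<sigma> * \<psi> (- int S # ms) else 0) + alt_flip S (- \<sigma>) (\<lambda>x. \<psi> (m # x)) ms"
  unfolding alt_flip_def length_Cons by (subst sum.lessThan_Suc_shift) (auto intro!: sum.cong)

lemma alt_flip_add: "alt_flip S \<sigma> (\<lambda>x. f x + g x) ms = alt_flip S \<sigma> f ms + alt_flip S \<sigma> g ms"
  unfolding alt_flip_def sum.distrib[symmetric] by (intro sum.cong) (auto simp: algebra_simps)

lemma alt_flip_mult: "alt_flip S \<sigma> (\<lambda>x. c * f x) ms = c * alt_flip S \<sigma> f ms"
  unfolding alt_flip_def sum_distrib_left by (intro sum.cong) auto

lemma alt_flip_sum: "alt_flip S \<sigma> (\<lambda>x. \<Sum>t\<in>T. f t x) ms = (\<Sum>t\<in>T. alt_flip S \<sigma> (f t) ms)"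
  unfolding alt_flip_def
  by (subst sum.swap) (auto simp: sum_distrib_left intro!: sum.cong)

text \<open>Each set of \<open>k + 1\<close> flipped sites arises \<open>k + 1\<close> times, once
  for each choice of the site flipped last.\<close>

lemma alt_flip_flip_amp:
  assumes S: "S \<ge> 1"
  shows "alt_flip S \<sigma> (\<lambda>ms. flip_amp S \<sigma> k s ms e) ms = of_nat (k + 1) * flip_amp S \<sigma> (k + 1) s ms e"
proof (induction ms arbitrary: \<sigma> k s)
  case Nil
  then show ?case by (simp add: alt_flip_def)
next
  case (Cons m ms)
  let ?X = "\<lambda>k. \<Sum>t\<le>S. aklt_A S m $$ (s, t) * flip_amp S (- \<sigma>) k t ms e"
  let ?Y = "\<lambda>k. \<Sum>t\<le>S. aklt_A S (- int S) $$ (s, t) * flip_amp S (- \<sigma>) k t ms e"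
  have "alt_flip S (- \<sigma>) (\<lambda>x. flip_amp S \<sigma> k s (m # x) e) ms =
      (\<Sum>t\<le>S. aklt_A S m $$ (s, t) * alt_flip S (- \<sigma>) (\<lambda>x. flip_amp S (- \<sigma>) k t x e) ms) +
      (if m = int S \<and> k > 0 then \<sigma> * (\<Sum>t\<le>S. aklt_A S (- int S) $$ (s, t) *
         alt_flip S (- \<sigma>) (\<lambda>x. flip_amp S (- \<sigma>) (k - 1) t x e) ms) else 0)"
  proof (cases "m = int S \<and> k > 0")
    case True
    then have "(m = int S \<and> k > 0) = True" by simp
    then show ?thesis
      unfolding flip_amp.simps if_True by (simp only: if_True alt_flip_add alt_flip_mult alt_flip_sum)
  next
    case False
    then have "(m = int S \<and> k > 0) = False" by simp
    then show ?thesis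
      unfolding flip_amp.simps by (simp only: if_False alt_flip_mult alt_flip_sum add_0_right)
  qed
  also have "\<dots> = of_nat (k + 1) * ?X (k + 1) + (if m = int S \<and> k > 0 then \<sigma> * (of_nat k * ?Y k) else 0)"
    unfolding Cons.IH sum_distrib_left by (auto intro!: sum.cong arg_cong2[where f = "(+)"])
  finally have "alt_flip S (- \<sigma>) (\<lambda>x. flip_amp S \<sigma> k s (m # x) e) ms =
      of_nat (k + 1) * ?X (k + 1) + (if m = int S \<and> k > 0 then \<sigma> * (of_nat k * ?Y k) else 0)" .
  \<comment> \<open>As \<open>S \<ge> 1\<close>, the letter \<open>-S\<close> differs from
    \<open>S\<close>, so a site cannot be flipped twice and the flip branch is off here.\<close>
  moreover have "flip_amp S \<sigma> k s (- int S # ms) e = ?Y k" using S by simp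
  ultimately show ?case
    by (auto simp: alt_flip_Cons algebra_simps)
qed

lemma spin_raise_funpow:
  assumes "j < length ms"
  shows "(spin_raise S (Suc j) ^^ r) \<psi> ms =
    complex_of_real (\<Prod>i<r. sqrt (real S * (real S + 1) - real_of_int (ms ! j - int i - 1) * real_of_int (ms ! j - int i)))
    * \<psi> (ms[j := ms ! j - int r])"
  using assms
proof (induction r arbitrary: ms)
  case (Suc r)
  have "(spin_raise S (Suc j) ^^ Suc r) \<psi> ms =
      complex_of_real (sqrt (real S * (real S + 1) - real_of_int (ms ! j - 1) * real_of_int (ms ! j)))
      * (spin_raise S (Suc j) ^^ r) \<psi> (ms[j := ms ! j - 1])"
    by (simp add: spin_raise_def Let_def)
  also have "\<dots> = complex_of_real (sqrt (real S * (real S + 1) - real_of_int (ms ! j - 1) * real_of_int (ms ! j))) *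
      (complex_of_real (\<Prod>i<r. sqrt (real S * (real S + 1) - real_of_int (ms ! j - int (Suc i) - 1) * real_of_int (ms ! j - int (Suc i))))
       * \<psi> (ms[j := ms ! j - int (Suc r)]))"
    using Suc.prems by (subst Suc.IH) (simp_all add: algebra_simps)
  finally show ?case
    by (subst prod.lessThan_Suc_shift) (simp add: mult.assoc)
qed simp

text \<open>The matrix element of the full ladder from \<open>-S\<close> to \<open>S\<close>, equal
  to (2S)!. Being positive, it cancels from the normalized eigenvalues.\<close>

definition raise_const :: "nat \<Rightarrow> real" where
  "raise_const S = (\<Prod>i<2 * S. sqrt (real S * (real S + 1) - real_of_int (int S - int i - 1) * real_of_int (int S - int i)))"

lemma raise_const_pos: "0 < raise_const S"
  unfolding raise_const_def
proof (rule prod_pos)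
  fix i assume "i \<in> {..<2 * S}"
  then have i: "real i < 2 * real S" by simp
  have "real S * (real S + 1) - real_of_int (int S - int i - 1) * real_of_int (int S - int i) =
      (real i + 1) * (2 * real S - real i)" by (simp add: algebra_simps)
  also have "\<dots> > 0" using i by (intro mult_pos_pos) auto
  finally show "0 < sqrt (real S * (real S + 1) - real_of_int (int S - int i - 1) * real_of_int (int S - int i))"
    by simp
qed

lemma set_configs: "set (configs S L) = {ms. length ms = L \<and> set ms \<subseteq> {- int S..int S}}"
  by (simp add: configs_def set_n_lists)

lemma tower_op_eq_alt_flip:
  assumes "ms \<in> set (configs S L)"
  shows "tower_op S L \<psi> ms = complex_of_real (raise_const S) * alt_flip S (-1) \<psi> ms"
proof -
  have len: "length ms = L" and rng: "set ms \<subseteq> {- int S..int S}" using assms by (auto simp: set_configs)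
  have "(spin_raise S (Suc j) ^^ (2 * S)) \<psi> ms =
      (if ms ! j = int S then complex_of_real (raise_const S) * \<psi> (ms[j := - int S]) else 0)" if j: "j < L" for j
  proof (cases "ms ! j = int S")
    case True
    then show ?thesis using spin_raise_funpow[of j ms "2 * S" S \<psi>] j len by (simp add: raise_const_def)
  next
    case False
    \<comment> \<open>The pull-back starts at a letter below \<open>S\<close> and descends
      \<open>2 * S\<close> times, so it must try to step below \<open>-S\<close>; at that step
      \<open>i\<close> the ladder factor vanishes.\<close>
    define i where "i = nat (ms ! j + int S)"
    have "ms ! j \<in> {- int S..int S}" using rng j len by (meson nth_mem subsetD)
    then have i: "i < 2 * S" "ms ! j - int i = - int S" using False by (auto simp: i_def)
    have "sqrt (real S * (real S + 1) - real_of_int (ms ! j - int i - 1) * real_of_int (ms ! j - int i)) = 0"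
      unfolding i(2) by (simp add: algebra_simps)
    then have "(\<Prod>i<2 * S. sqrt (real S * (real S + 1) - real_of_int (ms ! j - int i - 1) * real_of_int (ms ! j - int i))) = 0"
      using i(1) by (intro prod_zero) auto
    then show ?thesis using False spin_raise_funpow[of j ms "2 * S" S \<psi>] j len by simp
  qed
  then have "(\<Sum>j<L. (-1) ^ Suc j * (spin_raise S (Suc j) ^^ (2 * S)) \<psi> ms) =
      complex_of_real (raise_const S) * alt_flip S (-1) \<psi> ms"
    unfolding alt_flip_def len sum_distrib_left by (intro sum.cong) auto
  then show ?thesis unfolding tower_op_def One_nat_def sum.atLeast1_atMost_eq .
qed

text \<open>Every application contributes one ladder constant and, by
  \<open>alt_flip_flip_amp\<close>, the current number of flips; these numbers multiply to
  N!.\<close>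

lemma tower_state_eq_flip_amp:
  assumes "S \<ge> 1" "ms \<in> set (configs S L)"
  shows "tower_state S L N ms = complex_of_real (raise_const S ^ N * fact N) * flip_amp S (-1) N S ms 0"
  using assms(2)
proof (induction N arbitrary: ms)
  case 0
  then show ?case
    using foldr_aklt_A_eq_flip_amp[of S S 0 ms "-1"] by (simp add: tower_state_def aklt_SG_def)
next
  case (Suc N)
  let ?c = "complex_of_real (raise_const S ^ N * fact N)"
  \<comment> \<open>The induction hypothesis holds only on genuine configurations, and pulling back
    a letter stays among them.\<close>
  have upd: "ms[j := - int S] \<in> set (configs S L)" for j
    using Suc.prems set_update_subset_insert[of ms j "- int S"] by (auto simp: set_configs)
  have "tower_state S L (Suc N) ms = complex_of_real (raise_const S) * alt_flip S (-1) (tower_state S L N) ms"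
    by (simp add: tower_state_def tower_op_eq_alt_flip[OF Suc.prems])
  also have "alt_flip S (-1) (tower_state S L N) ms = alt_flip S (-1) (\<lambda>ms. ?c * flip_amp S (-1) N S ms 0) ms"
    unfolding alt_flip_def by (intro sum.cong) (auto simp: Suc.IH[OF upd])
  also have "\<dots> = ?c * (of_nat (N + 1) * flip_amp S (-1) (N + 1) S ms 0)"
    unfolding alt_flip_mult alt_flip_flip_amp[OF assms(1)] ..
  finally show ?case by (simp add: algebra_simps)
qed

section \<open>Cutting amplitudes and orthogonality\<close>

text \<open>Inserting the virtual label at the cut and distributing the flips over the two sides;
  the right side starts with the sign advanced by the length of the left.\<close>

lemma flip_amp_append:
  assumes "s \<le> S"
  shows "flip_amp S \<sigma> N s (a @ b) e =
    (\<Sum>k\<le>N. \<Sum>t\<le>S. flip_amp S \<sigma> k s a t * flip_amp S (\<sigma> * (-1) ^ length a) (N - k) t b e)"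
  using assms
proof (induction a arbitrary: \<sigma> N s)
  case Nil
  have "(\<Sum>t\<le>S. flip_amp S \<sigma> k s [] t * f t) = (if k = 0 then f s else 0)" for k and f :: "nat \<Rightarrow> complex"
  proof -
    have "(\<Sum>t\<le>S. flip_amp S \<sigma> k s [] t * f t) = (\<Sum>t\<in>{s}. flip_amp S \<sigma> k s [] t * f t)"
      using Nil by (intro sum.mono_neutral_right) auto
    then show ?thesis by simp
  qed
  then show ?case by simp
next
  case (Cons m a)
  let ?\<tau> = "\<sigma> * (-1) ^ length (m # a)"
  have \<tau>: "- \<sigma> * (-1) ^ length a = ?\<tau>" by simp
  define G where "G k t = flip_amp S ?\<tau> k t b e" for k t
  define F where "F k u t = flip_amp S (- \<sigma>) k u a t" for k u t
  have IH: "flip_amp S (- \<sigma>) M u (a @ b) e = (\<Sum>k\<le>M. \<Sum>t\<le>S. F k u t * G (M - k) t)" if "u \<le> S" for M u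
    using Cons.IH[OF that, of "- \<sigma>" M] unfolding \<tau> F_def G_def .
  have lin: "(\<Sum>u\<le>S. c u * (\<Sum>k\<le>M. \<Sum>t\<le>S. F k u t * G (M - k) t)) =
      (\<Sum>k\<le>M. \<Sum>t\<le>S. (\<Sum>u\<le>S. c u * F k u t) * G (M - k) t)" for c M
  proof -
    have "(\<Sum>u\<le>S. c u * (\<Sum>k\<le>M. \<Sum>t\<le>S. F k u t * G (M - k) t)) =
        (\<Sum>u\<le>S. \<Sum>k\<le>M. \<Sum>t\<le>S. c u * F k u t * G (M - k) t)"
      by (simp add: sum_distrib_left mult.assoc)
    also have "\<dots> = (\<Sum>k\<le>M. \<Sum>u\<le>S. \<Sum>t\<le>S. c u * F k u t * G (M - k) t)"
      by (rule sum.swap)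
    also have "\<dots> = (\<Sum>k\<le>M. \<Sum>t\<le>S. \<Sum>u\<le>S. c u * F k u t * G (M - k) t)"
      by (intro sum.cong refl sum.swap)
    finally show ?thesis by (simp add: sum_distrib_right)
  qed
  let ?x = "\<lambda>k t. \<Sum>u\<le>S. aklt_A S m $$ (s, u) * F k u t"
  let ?y = "\<lambda>k t. \<Sum>u\<le>S. aklt_A S (- int S) $$ (s, u) * F k u t"
  have rhs: "flip_amp S \<sigma> k s (m # a) t = ?x k t + (if m = int S \<and> k > 0 then \<sigma> * ?y (k - 1) t else 0)" for k t
    by (simp add: F_def)
  have step: "(\<Sum>u\<le>S. c u * flip_amp S (- \<sigma>) M u (a @ b) e) =
      (\<Sum>k\<le>M. \<Sum>t\<le>S. (\<Sum>u\<le>S. c u * F k u t) * G (M - k) t)" for c M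
    unfolding lin[symmetric] by (intro sum.cong refl arg_cong2[where f = "(*)"] IH) simp
  have "flip_amp S \<sigma> N s ((m # a) @ b) e = (\<Sum>k\<le>N. \<Sum>t\<le>S. ?x k t * G (N - k) t) +
     (if m = int S \<and> N > 0 then \<sigma> * (\<Sum>k\<le>N - 1. \<Sum>t\<le>S. ?y k t * G (N - 1 - k) t) else 0)"
    unfolding append_Cons flip_amp.simps step ..
  \<comment> \<open>A flip at the first letter uses up one of the left flips, so the index shifts by
    one and the \<open>k = 0\<close> term is zero.\<close>
  also have "(if m = int S \<and> N > 0 then \<sigma> * (\<Sum>k\<le>N - 1. \<Sum>t\<le>S. ?y k t * G (N - 1 - k) t) else 0) =
     (\<Sum>k\<le>N. \<Sum>t\<le>S. (if m = int S \<and> k > 0 then \<sigma> * ?y (k - 1) t else 0) * G (N - k) t)"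
  proof (cases N)
    case (Suc N')
    show ?thesis unfolding Suc
      by (subst sum.atMost_Suc_shift) (auto simp: sum_distrib_left mult.assoc intro!: sum.cong)
  qed simp
  finally show ?case
    unfolding rhs G_def[symmetric] by (simp add: distrib_right sum.distrib)
qed

text \<open>Conservation of \<open>S\<^sup>z\<close>: each flip adds \<open>2S\<close> to the magnetization fixed by the edge labels.\<close>

lemma flip_amp_charge:
  assumes "S \<ge> 1" "s \<le> S" "flip_amp S \<sigma> k s ms e \<noteq> 0"
  shows "sum_list ms = int s - int e + 2 * int S * int k"
  using assms(2,3)
proof (induction ms arbitrary: \<sigma> k s)
  case Nil
  then show ?case by (auto split: if_splits)
next
  case (Cons m ms)
  let ?X = "\<Sum>t\<le>S. aklt_A S m $$ (s, t) * flip_amp S (- \<sigma>) k t ms e"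
  let ?Y = "\<Sum>t\<le>S. aklt_A S (- int S) $$ (s, t) * flip_amp S (- \<sigma>) (k - 1) t ms e"
  have disj: "x \<noteq> 0 \<or> P \<and> y \<noteq> 0" if "x + (if P then z * y else 0) \<noteq> 0" for x y z :: complex and P
    using that by (auto split: if_splits)
  have "?X \<noteq> 0 \<or> (m = int S \<and> k > 0) \<and> ?Y \<noteq> 0"
    by (rule disj[where z = \<sigma>]) (rule Cons.prems(2)[unfolded flip_amp.simps])
  then consider "?X \<noteq> 0" | "m = int S" "k > 0" "?Y \<noteq> 0" by blast
  then show ?case
  proof cases
    case 1
    then obtain t where t: "t \<le> S" "aklt_A S m $$ (s, t) \<noteq> 0" "flip_amp S (- \<sigma>) k t ms e \<noteq> 0"
      by (auto elim!: sum.not_neutral_contains_not_neutral)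
    have "m = int s - int t" using aklt_A_eq_0[OF Cons.prems(1) t(1)] t(2) by blast
    then show ?thesis using Cons.IH[OF t(1,3)] by simp
  next
    case 2
    from 2(3) obtain t where t: "t \<le> S" "aklt_A S (- int S) $$ (s, t) \<noteq> 0" "flip_amp S (- \<sigma>) (k - 1) t ms e \<noteq> 0"
      by (auto elim!: sum.not_neutral_contains_not_neutral)
    have "- int S = int s - int t" using aklt_A_eq_0[OF Cons.prems(1) t(1)] t(2) by blast
    then show ?thesis using Cons.IH[OF t(1,3)] 2 by (simp add: of_nat_diff algebra_simps)
  qed
qed

text \<open>Division with remainder by \<open>2 * S\<close>: labels are at most
  \<open>S < 2 * S\<close>, so the label is the residue and the flip number the quotient.\<close>

lemma charge_unique:
  fixes k l t u :: nat
  assumes "S \<ge> 1" "t \<le> S" "u \<le> S" "int t + 2 * int S * int k = int u + 2 * int S * int l"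
  shows "t = u \<and> k = l"
proof -
  have "int (t + 2 * S * k) = int (u + 2 * S * l)" using assms(4) by simp
  then have eq: "t + 2 * S * k = u + 2 * S * l" by (simp only: of_nat_eq_iff)
  have "t < 2 * S" "u < 2 * S" using assms by auto
  then have "(t + 2 * S * k) mod (2 * S) = t" "(u + 2 * S * l) mod (2 * S) = u" by simp_all
  then have "t = u" using eq by simp
  then show ?thesis using eq assms(1) by simp
qed

text \<open>Stronger than orthogonality: the total magnetization of \<open>a\<close> already
  determines flip number and label, so the supports are disjoint. On the left the label enters with
  a minus sign, and \<open>S - t\<close> serves as residue.\<close>

lemma flip_amp_orthogonal_left:
  assumes "S \<ge> 1" "t \<le> S" "u \<le> S" "(k, t) \<noteq> (l, u)"
  shows "flip_amp S \<sigma> k S a t * cnj (flip_amp S \<sigma> l S a u) = 0"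
proof (rule ccontr)
  assume "flip_amp S \<sigma> k S a t * cnj (flip_amp S \<sigma> l S a u) \<noteq> 0"
  then have "int S - int t + 2 * int S * int k = int S - int u + 2 * int S * int l"
    using flip_amp_charge[OF assms(1) le_refl, of \<sigma> k a t] flip_amp_charge[OF assms(1) le_refl, of \<sigma> l a u] by auto
  then show False using charge_unique[OF assms(1), of u t k l] charge_unique[OF assms(1), of "S - t" "S - u" k l] assms
    by (auto simp: of_nat_diff)
qed

lemma flip_amp_orthogonal_right:
  assumes "S \<ge> 1" "t \<le> S" "u \<le> S" "(k, t) \<noteq> (l, u)"
  shows "flip_amp S \<sigma> k t b e * cnj (flip_amp S \<sigma> l u b e) = 0"
proof (rule ccontr)
  assume "flip_amp S \<sigma> k t b e * cnj (flip_amp S \<sigma> l u b e) \<noteq> 0"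
  then have "int t + 2 * int S * int k = int u + 2 * int S * int l"
    using flip_amp_charge[OF assms(1,2), of \<sigma> k b e] flip_amp_charge[OF assms(1,3), of \<sigma> l b e] by auto
  then show False using charge_unique[OF assms(1,2,3)] assms(4) by auto
qed

section \<open>Squared norms as a transfer recursion\<close>

text \<open>Squared norms of the flipped amplitudes. A flipped letter was \<open>-S\<close>, which
  forces the step from label 0 to label \<open>S\<close>; this is the marked step.\<close>

fun flip_weight :: "nat \<Rightarrow> nat \<Rightarrow> nat \<Rightarrow> nat \<Rightarrow> nat \<Rightarrow> real" where
  "flip_weight S 0 k s e = (if k = 0 \<and> s = e then 1 else 0)"
| "flip_weight S (Suc n) k s e = (\<Sum>t\<le>S. aklt_weight S s t * flip_weight S n k t e) +
    (if s = 0 \<and> k > 0 then aklt_weight S 0 S * flip_weight S n (k - 1) S e else 0)"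

lemma sum_configs_Suc:
  "(\<Sum>ms\<in>set (configs S (Suc n)). f ms) = (\<Sum>ms\<in>set (configs S n). \<Sum>m\<in>{- int S..int S}. f (m # ms))"
proof -
  have "set (configs S (Suc n)) = (\<lambda>(ms, m). m # ms) ` (set (configs S n) \<times> {- int S..int S})"
    by (force simp: set_configs length_Suc_conv image_iff)
  then have "(\<Sum>ms\<in>set (configs S (Suc n)). f ms) = (\<Sum>(ms, m)\<in>set (configs S n) \<times> {- int S..int S}. f (m # ms))"
    by (simp add: sum.reindex inj_on_def case_prod_unfold)
  then show ?thesis by (simp add: sum.cartesian_product)
qed

lemma sum_configs_append:
  "(\<Sum>ms\<in>set (configs S (n + n')). f ms) = (\<Sum>a\<in>set (configs S n). \<Sum>b\<in>set (configs S n'). f (a @ b))"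
proof -
  have "set (configs S (n + n')) = (\<lambda>(a, b). a @ b) ` (set (configs S n) \<times> set (configs S n'))"
  proof (intro equalityI subsetI)
    fix ms assume "ms \<in> set (configs S (n + n'))"
    then have "(take n ms, drop n ms) \<in> set (configs S n) \<times> set (configs S n')"
      by (auto simp: set_configs dest: in_set_takeD in_set_dropD)
    then show "ms \<in> (\<lambda>(a, b). a @ b) ` (set (configs S n) \<times> set (configs S n'))"
      by (metis (mono_tags, lifting) append_take_drop_id case_prod_conv image_eqI)
  qed (force simp: set_configs)
  moreover have "inj_on (\<lambda>(a, b). a @ b) (set (configs S n) \<times> set (configs S n'))"
    by (auto simp: inj_on_def set_configs)
  ultimately have "(\<Sum>ms\<in>set (configs S (n + n')). f ms) = (\<Sum>(a, b)\<in>set (configs S n) \<times> set (configs S n'). f (a @ b))"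
    by (simp add: sum.reindex case_prod_unfold)
  then show ?thesis by (simp add: sum.cartesian_product)
qed

text \<open>For fixed \<open>s\<close> each letter selects at most one next label in each sum, so
  summing over letters becomes summing over labels without cross terms. The tails \<open>f\<close>
  and \<open>g\<close> stay arbitrary so that the remaining letters can be held fixed.\<close>

lemma sum_one_site:
  assumes S: "S \<ge> 1" and s: "s \<le> S" and \<sigma>: "cmod \<sigma> = 1"
  shows "(\<Sum>m\<in>{- int S..int S}. (cmod ((\<Sum>t\<le>S. aklt_A S m $$ (s, t) * f t) +
      (if m = int S \<and> P then \<sigma> * (\<Sum>t\<le>S. aklt_A S (- int S) $$ (s, t) * g t) else 0)))\<^sup>2) =
    (\<Sum>t\<le>S. aklt_weight S s t * (cmod (f t))\<^sup>2) + (if s = 0 \<and> P then aklt_weight S 0 S * (cmod (g S))\<^sup>2 else 0)"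
proof -
  have single: "(\<Sum>t\<le>S. aklt_A S (int s - int t') $$ (s, t) * h t) = aklt_A S (int s - int t') $$ (s, t') * h t'"
    if "t' \<le> S" for t' h
  proof -
    have "(\<Sum>t\<le>S. aklt_A S (int s - int t') $$ (s, t) * h t) = (\<Sum>t\<in>{t'}. aklt_A S (int s - int t') $$ (s, t) * h t)"
      using that s by (intro sum.mono_neutral_right) (auto simp: aklt_A_eq_0)
    then show ?thesis by simp
  qed
  have none: "(\<Sum>t\<le>S. aklt_A S m $$ (s, t) * h t) = 0" if "\<And>t. t \<le> S \<Longrightarrow> m \<noteq> int s - int t" for m h
    using that s by (intro sum.neutral) (auto simp: aklt_A_eq_0)
  let ?X = "\<lambda>m. \<Sum>t\<le>S. aklt_A S m $$ (s, t) * f t"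
  let ?Y = "\<lambda>m. if m = int S \<and> P then \<sigma> * (\<Sum>t\<le>S. aklt_A S (- int S) $$ (s, t) * g t) else 0"
  \<comment> \<open>An unflipped letter \<open>S\<close> needs label \<open>s = S\<close>, a flipped one \<open>s = 0\<close>: no interference.\<close>
  have "?X m = 0 \<or> ?Y m = 0" for m
  proof (cases "m = int S \<and> s = 0")
    case True
    then have "?X m = 0" using S by (intro none) auto
    then show ?thesis ..
  next
    case False
    then have "?Y m = 0" using none[of "- int S" g] by auto
    then show ?thesis ..
  qed
  moreover have "(cmod (x + y))\<^sup>2 = (cmod x)\<^sup>2 + (cmod y)\<^sup>2" if "x = 0 \<or> y = 0" for x y
    using that by auto
  ultimately have "(cmod (?X m + ?Y m))\<^sup>2 = (cmod (?X m))\<^sup>2 + (cmod (?Y m))\<^sup>2" for m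
    by blast
  then have "(\<Sum>m\<in>{- int S..int S}. (cmod (?X m + ?Y m))\<^sup>2) =
      (\<Sum>m\<in>{- int S..int S}. (cmod (?X m))\<^sup>2) + (\<Sum>m\<in>{- int S..int S}. (cmod (?Y m))\<^sup>2)"
    unfolding sum.distrib[symmetric] by (intro sum.cong refl)
  also have "(\<Sum>m\<in>{- int S..int S}. (cmod (?X m))\<^sup>2) = (\<Sum>m\<in>(\<lambda>t. int s - int t) ` {..S}. (cmod (?X m))\<^sup>2)"
  proof (rule sum.mono_neutral_right)
    show "\<forall>m\<in>{- int S..int S} - (\<lambda>t. int s - int t) ` {..S}. (cmod (?X m))\<^sup>2 = 0"
      using none[of _ f] by fastforce
  qed (use s in auto)
  also have "\<dots> = (\<Sum>t\<le>S. aklt_weight S s t * (cmod (f t))\<^sup>2)"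
    using s by (subst sum.reindex) (auto simp: inj_on_def single norm_mult power_mult_distrib aklt_A_norm)
  also have "(\<Sum>m\<in>{- int S..int S}. (cmod (?Y m))\<^sup>2) = (\<Sum>m\<in>{int S}. (cmod (?Y m))\<^sup>2)"
    by (rule sum.mono_neutral_right) auto
  also have "\<dots> = (if s = 0 \<and> P then aklt_weight S 0 S * (cmod (g S))\<^sup>2 else 0)"
  proof (cases "s = 0")
    case True
    then show ?thesis using single[of S g] aklt_A_norm[of 0 S S "- int S"] \<sigma>
      by (auto simp: norm_mult power_mult_distrib)
  next
    case False
    then show ?thesis using none[of "- int S" g] by auto
  qed
  finally show ?thesis .
qed

lemma sum_flip_amp_norm:
  assumes S: "S \<ge> 1" and "cmod \<sigma> = 1" "s \<le> S"
  shows "(\<Sum>ms\<in>set (configs S n). (cmod (flip_amp S \<sigma> k s ms e))\<^sup>2) = flip_weight S n k s e"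
  using assms(2,3)
proof (induction n arbitrary: \<sigma> k s)
  case 0
  then show ?case by (simp add: configs_def)
next
  case (Suc n)
  have "(\<Sum>ms\<in>set (configs S (Suc n)). (cmod (flip_amp S \<sigma> k s ms e))\<^sup>2) =
    (\<Sum>ms\<in>set (configs S n). (\<Sum>t\<le>S. aklt_weight S s t * (cmod (flip_amp S (- \<sigma>) k t ms e))\<^sup>2) +
     (if s = 0 \<and> k > 0 then aklt_weight S 0 S * (cmod (flip_amp S (- \<sigma>) (k - 1) S ms e))\<^sup>2 else 0))"
    unfolding sum_configs_Suc flip_amp.simps by (intro sum.cong refl sum_one_site S Suc.prems)
  also have "\<dots> = (\<Sum>t\<le>S. aklt_weight S s t * (\<Sum>ms\<in>set (configs S n). (cmod (flip_amp S (- \<sigma>) k t ms e))\<^sup>2)) +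
     (if s = 0 \<and> k > 0 then aklt_weight S 0 S * (\<Sum>ms\<in>set (configs S n). (cmod (flip_amp S (- \<sigma>) (k - 1) S ms e))\<^sup>2) else 0)"
    unfolding sum.distrib by (subst sum.swap) (simp add: sum_distrib_left)
  also have "\<dots> = flip_weight S (Suc n) k s e"
    using Suc.prems by (simp add: Suc.IH)
  finally show ?case .
qed

section \<open>Schmidt decomposition and limits\<close>

lemma proots_char_poly_mat_diag:
  fixes d :: "nat \<Rightarrow> complex"
  shows "proots (char_poly (mat_diag n d)) = mset (map d [0..<n])"
  using eigenvalues_mset_similar_mat_diag[OF similar_mat_wit_refl[OF mat_diag_dim] carrier_matD(1)[OF mat_diag_dim]]
  unfolding eigenvalues_mset_def .

text \<open>By Sylvester's identity the two characteristic polynomials agree up to powers of x,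
  which only affect the root 0.\<close>

lemma nonzero_eigenvalues_mult_commute:
  assumes "X \<in> carrier_mat n m" "Y \<in> carrier_mat m n"
  shows "nonzero_eigenvalues (X * Y) = nonzero_eigenvalues (Y * X)"
proof -
  have nz: "char_poly (X * Y) \<noteq> 0" "char_poly (Y * X) \<noteq> 0"
    using degree_monic_char_poly[of "X * Y" n] degree_monic_char_poly[of "Y * X" m] assms by auto
  have "filter_mset (\<lambda>x. x \<noteq> 0) (proots ([:0, 1:] ^ k * p)) = filter_mset (\<lambda>x. x \<noteq> 0) (proots p)"
    if "p \<noteq> 0" for k and p :: "complex poly"
  proof -
    have "proots ([:0, 1:] ^ k * p) = repeat_mset k {#0#} + proots p"
      using that proots_linear_factor[of "0 :: complex"] by (subst proots_mult) (auto simp: proots_power)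
    moreover have "{#x \<in># repeat_mset k {#0 :: complex#}. x \<noteq> 0#} = {#}"
      by (rule multiset_eqI) simp
    ultimately show ?thesis by simp
  qed
  from this[OF nz(1), of m] this[OF nz(2), of n] show ?thesis
    unfolding nonzero_eigenvalues_def eigenvalues_mset_def char_poly_mult_commute[OF assms] by simp
qed

lemma sum_gram:
  fixes Y :: "nat \<Rightarrow> 'b \<Rightarrow> complex"
  assumes "\<And>\<alpha> \<beta>. \<alpha> < r \<Longrightarrow> \<beta> < r \<Longrightarrow> (\<Sum>b\<in>T. Y \<alpha> b * cnj (Y \<beta> b)) = (if \<alpha> = \<beta> then complex_of_real (y \<alpha>) else 0)"
  shows "(\<Sum>b\<in>T. (\<Sum>\<alpha><r. A \<alpha> * Y \<alpha> b) * cnj (\<Sum>\<alpha><r. B \<alpha> * Y \<alpha> b)) =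
    (\<Sum>\<alpha><r. A \<alpha> * cnj (B \<alpha>) * complex_of_real (y \<alpha>))"
proof -
  have "(\<Sum>b\<in>T. (\<Sum>\<alpha><r. A \<alpha> * Y \<alpha> b) * cnj (\<Sum>\<alpha><r. B \<alpha> * Y \<alpha> b)) =
      (\<Sum>b\<in>T. \<Sum>\<alpha><r. \<Sum>\<beta><r. A \<alpha> * cnj (B \<beta>) * (Y \<alpha> b * cnj (Y \<beta> b)))"
    by (simp add: sum_product mult_ac)
  also have "\<dots> = (\<Sum>\<alpha><r. \<Sum>b\<in>T. \<Sum>\<beta><r. A \<alpha> * cnj (B \<beta>) * (Y \<alpha> b * cnj (Y \<beta> b)))"
    by (rule sum.swap)
  also have "\<dots> = (\<Sum>\<alpha><r. \<Sum>\<beta><r. \<Sum>b\<in>T. A \<alpha> * cnj (B \<beta>) * (Y \<alpha> b * cnj (Y \<beta> b)))"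
    by (intro sum.cong refl sum.swap)
  also have "\<dots> = (\<Sum>\<alpha><r. \<Sum>\<beta><r. if \<alpha> = \<beta> then A \<alpha> * cnj (B \<beta>) * complex_of_real (y \<alpha>) else 0)"
    by (intro sum.cong refl) (auto simp: assms simp flip: sum_distrib_left)
  finally show ?thesis by simp
qed

lemma sum_configs_nth: "(\<Sum>i<length (configs S n). f (configs S n ! i)) = (\<Sum>a\<in>set (configs S n). f a)"
proof -
  have "distinct (configs S n)" unfolding configs_def by (intro distinct_n_lists) simp
  from sum.reindex_bij_betw[OF bij_betw_nth[OF this refl refl], of f] show ?thesis
    by (simp add: lessThan_def)
qed

lemma reduced_density_adjoint: "mat_adjoint (reduced_density S L n \<psi>) = reduced_density S L n \<psi>"
  by (rule eq_matI) (auto simp: mat_adjoint_index reduced_density_def Let_def state_norm2_def mult.commute)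

text \<open>The density matrix factors through the \<open>r\<close> Schmidt indices, and the
  reversed product is the Gram matrix of the \<open>X\<close>, weighted by \<open>y\<close>: a
  diagonal matrix. Vectors of norm zero merely contribute zeros, which the filter removes.\<close>

lemma schmidt_eigenvalues:
  fixes X Y :: "nat \<Rightarrow> int list \<Rightarrow> complex" and x y :: "nat \<Rightarrow> real"
  assumes \<psi>: "\<And>a b. a \<in> set (configs S n) \<Longrightarrow> b \<in> set (configs S n') \<Longrightarrow> \<psi> (a @ b) = (\<Sum>\<alpha><r. X \<alpha> a * Y \<alpha> b)"
    and X: "\<And>\<alpha> \<beta>. \<alpha> < r \<Longrightarrow> \<beta> < r \<Longrightarrow>
      (\<Sum>a\<in>set (configs S n). X \<alpha> a * cnj (X \<beta> a)) = (if \<alpha> = \<beta> then complex_of_real (x \<alpha>) else 0)"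
    and Y: "\<And>\<alpha> \<beta>. \<alpha> < r \<Longrightarrow> \<beta> < r \<Longrightarrow>
      (\<Sum>b\<in>set (configs S n'). Y \<alpha> b * cnj (Y \<beta> b)) = (if \<alpha> = \<beta> then complex_of_real (y \<alpha>) else 0)"
  shows "nonzero_eigenvalues (reduced_density S (n + n') n \<psi>) =
    {#z \<in># mset (map (\<lambda>\<alpha>. complex_of_real (x \<alpha> * y \<alpha> / (\<Sum>\<beta><r. x \<beta> * y \<beta>))) [0..<r]). z \<noteq> 0#}"
proof -
  define Z where "Z = (\<Sum>\<beta><r. x \<beta> * y \<beta>)"
  define cs where "cs = configs S n"
  \<comment> \<open>The weights \<open>y / Z\<close> go entirely into \<open>P\<close>, which avoids
    square roots.\<close>
  define P where "P = mat (length cs) r (\<lambda>(i, \<alpha>). X \<alpha> (cs ! i) * complex_of_real (y \<alpha> / Z))"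
  define Q where "Q = mat r (length cs) (\<lambda>(\<alpha>, j). cnj (X \<alpha> (cs ! j)))"
  have P: "P \<in> carrier_mat (length cs) r" and Q: "Q \<in> carrier_mat r (length cs)" by (auto simp: P_def Q_def)
  have inner: "(\<Sum>b\<in>set (configs S n'). \<psi> (a @ b) * cnj (\<psi> (a' @ b))) =
      (\<Sum>\<alpha><r. X \<alpha> a * cnj (X \<alpha> a') * complex_of_real (y \<alpha>))"
    if "a \<in> set cs" "a' \<in> set cs" for a a'
    using that sum_gram[OF Y, of r "\<lambda>\<alpha>. X \<alpha> a" "\<lambda>\<alpha>. X \<alpha> a'"] \<psi> by (simp add: cs_def)
  have "state_norm2 S (n + n') \<psi> = (\<Sum>a\<in>set cs. \<Sum>\<alpha><r. X \<alpha> a * cnj (X \<alpha> a) * complex_of_real (y \<alpha>))"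
    unfolding state_norm2_def sum_configs_append cs_def[symmetric] by (intro sum.cong refl inner)
  also have "\<dots> = (\<Sum>\<alpha><r. (\<Sum>a\<in>set cs. X \<alpha> a * cnj (X \<alpha> a)) * complex_of_real (y \<alpha>))"
    by (subst sum.swap) (simp add: sum_distrib_right)
  also have "\<dots> = complex_of_real Z"
    using X by (simp add: Z_def cs_def)
  finally have norm: "state_norm2 S (n + n') \<psi> = complex_of_real Z" .
  have "reduced_density S (n + n') n \<psi> = P * Q"
  proof (rule eq_matI)
    fix i j assume "i < dim_row (P * Q)" "j < dim_col (P * Q)"
    then have ij: "i < length cs" "j < length cs" using P Q by auto
    then have "reduced_density S (n + n') n \<psi> $$ (i, j) =
        (\<Sum>\<alpha><r. X \<alpha> (cs ! i) * cnj (X \<alpha> (cs ! j)) * complex_of_real (y \<alpha>)) / complex_of_real Z"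
      using inner[of "cs ! i" "cs ! j"] by (simp add: reduced_density_def Let_def norm flip: cs_def)
    also have "\<dots> = (P * Q) $$ (i, j)"
      unfolding index_mult_mat_sum[OF P Q ij] using ij
      by (simp add: P_def Q_def sum_divide_distrib mult_ac)
    finally show "reduced_density S (n + n') n \<psi> $$ (i, j) = (P * Q) $$ (i, j)" .
  qed (use P Q in \<open>auto simp: reduced_density_def Let_def cs_def\<close>)
  then have "nonzero_eigenvalues (reduced_density S (n + n') n \<psi>) = nonzero_eigenvalues (Q * P)"
    using nonzero_eigenvalues_mult_commute[OF P Q] by simp
  also have "Q * P = mat_diag r (\<lambda>\<alpha>. complex_of_real (x \<alpha> * y \<alpha> / Z))"
  proof (rule eq_matI)
    fix \<alpha> \<beta> assume "\<alpha> < dim_row (mat_diag r (\<lambda>\<alpha>. complex_of_real (x \<alpha> * y \<alpha> / Z)))"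
      "\<beta> < dim_col (mat_diag r (\<lambda>\<alpha>. complex_of_real (x \<alpha> * y \<alpha> / Z)))"
    then have ab: "\<alpha> < r" "\<beta> < r" by (auto simp: mat_diag_def)
    have "(Q * P) $$ (\<alpha>, \<beta>) = (\<Sum>i<length cs. X \<beta> (cs ! i) * cnj (X \<alpha> (cs ! i))) * complex_of_real (y \<beta> / Z)"
      unfolding index_mult_mat_sum[OF Q P ab] sum_distrib_right using ab
      by (intro sum.cong) (auto simp: P_def Q_def)
    also have "(\<Sum>i<length cs. X \<beta> (cs ! i) * cnj (X \<alpha> (cs ! i))) = (if \<beta> = \<alpha> then complex_of_real (x \<beta>) else 0)"
      unfolding cs_def using sum_configs_nth[where f = "\<lambda>a. X \<beta> a * cnj (X \<alpha> a)"] X[OF ab(2,1)] by simp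
    finally show "(Q * P) $$ (\<alpha>, \<beta>) = mat_diag r (\<lambda>\<alpha>. complex_of_real (x \<alpha> * y \<alpha> / Z)) $$ (\<alpha>, \<beta>)"
      using ab by (auto simp: mat_diag_def)
  qed (use P Q in \<open>auto simp: mat_diag_def\<close>)
  also have "nonzero_eigenvalues \<dots> = {#z \<in># mset (map (\<lambda>\<alpha>. complex_of_real (x \<alpha> * y \<alpha> / Z)) [0..<r]). z \<noteq> 0#}"
    by (simp only: nonzero_eigenvalues_def eigenvalues_mset_def proots_char_poly_mat_diag)
  finally show ?thesis unfolding Z_def .
qed

lemma sum_div_mod:
  fixes f :: "nat \<Rightarrow> nat \<Rightarrow> 'a :: comm_monoid_add"
  assumes "d > 0"
  shows "(\<Sum>\<alpha><m * d. f (\<alpha> div d) (\<alpha> mod d)) = (\<Sum>k<m. \<Sum>t<d. f k t)"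
proof -
  have "(\<Sum>\<alpha><m * d. f (\<alpha> div d) (\<alpha> mod d)) = (\<Sum>(k, t)\<in>{..<m} \<times> {..<d}. f k t)"
  proof (rule sum.reindex_bij_witness[of _ "\<lambda>(k, t). k * d + t" "\<lambda>\<alpha>. (\<alpha> div d, \<alpha> mod d)"])
    fix kt assume "kt \<in> {..<m} \<times> {..<d}"
    then obtain k t where kt: "kt = (k, t)" "k < m" "t < d" by auto
    have "k * d + t < (k + 1) * d" using kt by simp
    also have "\<dots> \<le> m * d" using kt by (intro mult_le_mono1) simp
    finally show "(case kt of (k, t) \<Rightarrow> k * d + t) \<in> {..<m * d}" using kt by simp
  qed (use assms in \<open>auto simp: less_mult_imp_div_less\<close>)
  then show ?thesis by (simp add: sum.cartesian_product)
qed

definition schmidt_weight :: "nat \<Rightarrow> nat \<Rightarrow> nat \<Rightarrow> nat \<Rightarrow> nat \<Rightarrow> real" where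
  "schmidt_weight S N n k t = flip_weight S n k S t * flip_weight S n (N - k) t 0"

text \<open>The Schmidt pair of flip number \<open>k\<close> and label \<open>t\<close> is numbered
  as \<open>\<alpha> = k * (S + 1) + t\<close>.\<close>

definition tower_eigenvalue :: "nat \<Rightarrow> nat \<Rightarrow> nat \<Rightarrow> nat \<Rightarrow> real" where
  "tower_eigenvalue S N n \<alpha> = schmidt_weight S N n (\<alpha> div (S + 1)) (\<alpha> mod (S + 1)) /
     (\<Sum>k<N + 1. \<Sum>t<S + 1. schmidt_weight S N n k t)"

lemma tower_rho_nonzero_eigenvalues:
  assumes S: "S \<ge> 1"
  shows "nonzero_eigenvalues (tower_rho S N n) =
    {#z \<in># mset (map (\<lambda>\<alpha>. complex_of_real (tower_eigenvalue S N n \<alpha>)) [0..<(N + 1) * (S + 1)]). z \<noteq> 0#}"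
proof -
  define d where "d = S + 1"
  define r where "r = (N + 1) * d"
  define c where "c = raise_const S ^ N * fact N"
  \<comment> \<open>The staggered sign of the first site of the right half. It has modulus 1, so
    both halves have the same transfer weights.\<close>
  define \<tau> :: complex where "\<tau> = - 1 * (-1) ^ n"
  have c: "c > 0" using raise_const_pos[of S] by (simp add: c_def)
  have d: "d > 0" by (simp add: d_def)
  have \<tau>: "cmod \<tau> = 1" by (simp add: \<tau>_def norm_mult norm_power)
  define X where "X \<alpha> a = complex_of_real c * flip_amp S (-1) (\<alpha> div d) S a (\<alpha> mod d)" for \<alpha> a
  define Y where "Y \<alpha> b = flip_amp S \<tau> (N - \<alpha> div d) (\<alpha> mod d) b 0" for \<alpha> b
  define x where "x \<alpha> = c\<^sup>2 * flip_weight S n (\<alpha> div d) S (\<alpha> mod d)" for \<alpha>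
  define y where "y \<alpha> = flip_weight S n (N - \<alpha> div d) (\<alpha> mod d) 0" for \<alpha>
  have modle: "\<alpha> mod d \<le> S" for \<alpha> using mod_less_divisor[OF d, of \<alpha>] by (simp add: d_def)
  have divle: "\<alpha> div d \<le> N" if "\<alpha> < r" for \<alpha>
    using less_mult_imp_div_less[of \<alpha> "N + 1" d] that by (simp add: r_def)
  have ne: "(\<alpha> div d, \<alpha> mod d) \<noteq> (\<beta> div d, \<beta> mod d)" if "\<alpha> \<noteq> \<beta>" for \<alpha> \<beta>
    using that by (metis Pair_inject div_mult_mod_eq)
  have sq: "z * cnj z = complex_of_real ((cmod z)\<^sup>2)" for z by (rule complex_norm_square[symmetric])
  have "nonzero_eigenvalues (reduced_density S (n + n) n (tower_state S (2 * n) N)) =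
    {#z \<in># mset (map (\<lambda>\<alpha>. complex_of_real (x \<alpha> * y \<alpha> / (\<Sum>\<beta><r. x \<beta> * y \<beta>))) [0..<r]). z \<noteq> 0#}"
  proof (rule schmidt_eigenvalues[where X = X and Y = Y])
    fix a b assume ab: "a \<in> set (configs S n)" "b \<in> set (configs S n)"
    then have "a @ b \<in> set (configs S (2 * n))" and len: "length a = n" by (auto simp: set_configs)
    from tower_state_eq_flip_amp[OF S this(1), of N]
    have "tower_state S (2 * n) N (a @ b) = complex_of_real c * flip_amp S (-1) N S (a @ b) 0"
      by (simp add: c_def)
    also have "\<dots> = complex_of_real c * (\<Sum>k\<le>N. \<Sum>t\<le>S. flip_amp S (-1) k S a t * flip_amp S \<tau> (N - k) t b 0)"
      unfolding flip_amp_append[OF le_refl] len \<tau>_def ..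
    also have "\<dots> = complex_of_real c * (\<Sum>k<N + 1. \<Sum>t<d. flip_amp S (-1) k S a t * flip_amp S \<tau> (N - k) t b 0)"
      by (simp add: d_def lessThan_Suc_atMost)
    also have "\<dots> = (\<Sum>\<alpha><r. X \<alpha> a * Y \<alpha> b)"
      unfolding sum_div_mod[OF d, symmetric] r_def X_def Y_def by (simp add: sum_distrib_left mult.assoc)
    finally show "tower_state S (2 * n) N (a @ b) = (\<Sum>\<alpha><r. X \<alpha> a * Y \<alpha> b)" .
  next
    fix \<alpha> \<beta> assume "\<alpha> < r" "\<beta> < r"
    show "(\<Sum>a\<in>set (configs S n). X \<alpha> a * cnj (X \<beta> a)) = (if \<alpha> = \<beta> then complex_of_real (x \<alpha>) else 0)"
    proof (cases "\<alpha> = \<beta>")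
      case True
      have "(\<Sum>a\<in>set (configs S n). X \<beta> a * cnj (X \<beta> a)) = complex_of_real (c\<^sup>2 * (\<Sum>a\<in>set (configs S n). (cmod (flip_amp S (-1) (\<beta> div d) S a (\<beta> mod d)))\<^sup>2))"
        unfolding sq X_def norm_mult power_mult_distrib using c by (simp add: sum_distrib_left)
      also have "(\<Sum>a\<in>set (configs S n). (cmod (flip_amp S (-1) (\<beta> div d) S a (\<beta> mod d)))\<^sup>2) =
          flip_weight S n (\<beta> div d) S (\<beta> mod d)"
        by (rule sum_flip_amp_norm[OF S]) simp_all
      finally show ?thesis using True by (simp add: x_def)
    next
      case False
      have "X \<alpha> a * cnj (X \<beta> a) = 0" for a
        using flip_amp_orthogonal_left[OF S modle modle ne[OF False], of "-1" a] by (auto simp: X_def)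
      then show ?thesis using False by simp
    qed
  next
    fix \<alpha> \<beta> assume ab: "\<alpha> < r" "\<beta> < r"
    show "(\<Sum>b\<in>set (configs S n). Y \<alpha> b * cnj (Y \<beta> b)) = (if \<alpha> = \<beta> then complex_of_real (y \<alpha>) else 0)"
    proof (cases "\<alpha> = \<beta>")
      case True
      have "(\<Sum>b\<in>set (configs S n). Y \<beta> b * cnj (Y \<beta> b)) =
          complex_of_real (\<Sum>b\<in>set (configs S n). (cmod (Y \<beta> b))\<^sup>2)"
        unfolding sq by simp
      also have "(\<Sum>b\<in>set (configs S n). (cmod (Y \<beta> b))\<^sup>2) = y \<beta>"
        unfolding Y_def y_def by (rule sum_flip_amp_norm[OF S \<tau> modle])
      finally show ?thesis using True by simp
    next
      case False
      \<comment> \<open>Truncated subtraction from \<open>N\<close> is injective here because both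
        flip numbers are at most \<open>N\<close>.\<close>
      have "(N - \<alpha> div d, \<alpha> mod d) \<noteq> (N - \<beta> div d, \<beta> mod d)"
        using ne[OF False] divle[OF ab(1)] divle[OF ab(2)] by auto
      then have "Y \<alpha> b * cnj (Y \<beta> b) = 0" for b
        unfolding Y_def by (intro flip_amp_orthogonal_right[OF S modle modle])
      then show ?thesis using False by simp
    qed
  qed
  moreover have "x \<alpha> * y \<alpha> / (\<Sum>\<beta><r. x \<beta> * y \<beta>) = tower_eigenvalue S N n \<alpha>" for \<alpha>
  proof -
    have xy: "x \<beta> * y \<beta> = c\<^sup>2 * schmidt_weight S N n (\<beta> div d) (\<beta> mod d)" for \<beta>
      by (simp add: x_def y_def schmidt_weight_def)
    show ?thesis
      unfolding xy sum_distrib_left[symmetric] r_def sum_div_mod[OF d] tower_eigenvalue_def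
      using c by (simp add: d_def)
  qed
  ultimately show ?thesis
    by (simp only: tower_rho_def mult_2 r_def d_def)
qed

section \<open>Limits of the Schmidt weights\<close>

text \<open>Dividing by \<open>aklt_norm\<close> at each step makes the transfer matrix doubly
  stochastic: rows by the row sum, columns by symmetry. The marked step leads from label 0 to label
  \<open>S\<close>.\<close>

lemma flip_weight_binomial_asymptotics:
  assumes "s \<le> S" "e \<le> S"
  shows "(\<lambda>n. flip_weight S n k s e / aklt_norm S ^ n / real ((n + k) choose k)) \<longlonglongrightarrow>
    (aklt_weight S 0 S / aklt_norm S / real (S + 1)) ^ k / real (S + 1)"
proof (rule doubly_stochastic_tower_asymptotics[where Q = "\<lambda>s t. aklt_weight S s t / aklt_norm S" 
      and v = "\<lambda>n k s. flip_weight S n k s e / aklt_norm S ^ n" and a = 0 and b = S])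
  note pos = aklt_norm_pos[of S]
  have range: "{..<S + 1} = {..S}" by auto
  show "0 < aklt_weight S s t / aklt_norm S" if "s < S + 1" "t < S + 1" for s t
    using that pos by (simp add: aklt_weight_pos)
  show rows: "(\<Sum>t<S + 1. aklt_weight S s t / aklt_norm S) = 1" if "s < S + 1" for s
    unfolding range sum_divide_distrib[symmetric] using that pos aklt_weight_row_sum[of s S] by simp
  show "(\<Sum>s<S + 1. aklt_weight S s t / aklt_norm S) = 1" if "t < S + 1" for t
  proof -
    have "(\<Sum>s<S + 1. aklt_weight S s t / aklt_norm S) = (\<Sum>s<S + 1. aklt_weight S t s / aklt_norm S)"
      using that by (intro sum.cong) (auto simp: aklt_weight_sym)
    then show ?thesis using rows[OF that] by simp
  qed
  show "(\<Sum>s<S + 1. flip_weight S 0 0 s e / aklt_norm S ^ 0) = 1" using assms(2) by simp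
  show "flip_weight S (Suc n) 0 s e / aklt_norm S ^ Suc n =
      (\<Sum>t<S + 1. aklt_weight S s t / aklt_norm S * (flip_weight S n 0 t e / aklt_norm S ^ n))" for n s
    unfolding range by (simp add: sum_divide_distrib)
  show "flip_weight S (Suc n) (Suc k) s e / aklt_norm S ^ Suc n =
      (\<Sum>t<S + 1. aklt_weight S s t / aklt_norm S * (flip_weight S n (Suc k) t e / aklt_norm S ^ n)) +
      (if s = 0 then aklt_weight S 0 S / aklt_norm S * (flip_weight S n k S e / aklt_norm S ^ n) else 0)" for n k s
    unfolding range by (simp add: sum_divide_distrib add_divide_distrib)
qed (use assms in auto)

lemma binomial_power_asymptotics: "(\<lambda>n. real ((n + k) choose k) / real n ^ k) \<longlonglongrightarrow> 1 / fact k"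
proof (induction k)
  case (Suc k)
  have "(\<lambda>n. real ((n + k) choose k) / real n ^ k * ((1 + real (Suc k) / real n) / real (Suc k)))
      \<longlonglongrightarrow> 1 / fact k * ((1 + 0) / real (Suc k))"
    by (intro tendsto_intros Suc lim_const_over_n) auto
  moreover have "eventually (\<lambda>n. real ((n + k) choose k) / real n ^ k * ((1 + real (Suc k) / real n) / real (Suc k)) =
      real ((n + Suc k) choose Suc k) / real n ^ Suc k) sequentially"
    using eventually_gt_at_top[of 0]
  proof eventually_elim
    case (elim n)
    have "real (Suc k * (Suc (n + k) choose Suc k)) = real (Suc (n + k) * ((n + k) choose k))"
      using Suc_times_binomial_eq[of "n + k" k] by (simp only: mult.commute)
    then have b: "real ((n + Suc k) choose Suc k) = real (n + Suc k) * real ((n + k) choose k) / real (Suc k)"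
      by (simp only: of_nat_mult add_Suc_right) (simp add: eq_divide_eq mult.commute del: binomial_Suc_Suc)
    have "1 + real (Suc k) / real n = real (n + Suc k) / real n" using elim by (simp add: field_simps)
    then show ?case unfolding b by (simp only: power_Suc times_divide_times_eq) (simp add: mult_ac)
  qed
  ultimately show ?case by (simp add: Lim_transform_eventually mult.commute)
qed simp

text \<open>Powers replace binomials because the powers of \<open>n\<close> from the two halves
  multiply to the same \<open>n ^ N\<close> for every \<open>k\<close>; the exchange produces the
  factor 1 / k!.\<close>

lemma flip_weight_asymptotics:
  assumes "s \<le> S" "e \<le> S"
  shows "(\<lambda>n. flip_weight S n k s e / (aklt_norm S ^ n * real n ^ k)) \<longlonglongrightarrow>
    (aklt_weight S 0 S / aklt_norm S / real (S + 1)) ^ k / real (S + 1) / fact k"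
proof -
  have "flip_weight S n k s e / aklt_norm S ^ n / real ((n + k) choose k) * (real ((n + k) choose k) / real n ^ k) =
      flip_weight S n k s e / (aklt_norm S ^ n * real n ^ k)" for n
    by simp
  with tendsto_mult[OF flip_weight_binomial_asymptotics[OF assms, of k] binomial_power_asymptotics[of k]]
  show ?thesis by simp
qed

lemma sum_inverse_fact: "(\<Sum>k<N + 1. 1 / (fact k * fact (N - k))) = (2 ^ N / fact N :: real)"
proof -
  have "(\<Sum>k<N + 1. 1 / (fact k * fact (N - k))) = (\<Sum>k\<le>N. real (N choose k) / fact N)"
    by (intro sum.cong) (auto simp: binomial_fact)
  also have "\<dots> = real (\<Sum>k\<le>N. N choose k) / fact N" by (simp add: sum_divide_distrib)
  finally show ?thesis by (simp add: choose_row_sum)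
qed

lemma tower_eigenvalue_tendsto:
  assumes "\<alpha> < (N + 1) * (S + 1)"
  shows "(\<lambda>n. tower_eigenvalue S N n \<alpha>) \<longlonglongrightarrow> limit_eigenvalue S N (\<alpha> div (S + 1))"
proof -
  define \<kappa> where "\<kappa> = aklt_norm S"
  have \<kappa>: "\<kappa> > 0" by (simp add: \<kappa>_def aklt_norm_pos)
  define g where "g = aklt_weight S 0 S / \<kappa> / real (S + 1)"
  have g: "g > 0" using \<kappa> aklt_weight_pos[of 0 S S] by (simp add: g_def)
  \<comment> \<open>The common scale of all Schmidt weights. It does not depend on \<open>k\<close>
    or \<open>t\<close>, so it and the constant \<open>C\<close> cancel in the quotient.\<close>
  define D where "D n = \<kappa> ^ n * \<kappa> ^ n * real n ^ N" for n
  define C where "C = g ^ N / real (S + 1) / real (S + 1)"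
  have C: "C > 0" using g by (simp add: C_def)
  have w: "(\<lambda>n. schmidt_weight S N n k t / D n) \<longlonglongrightarrow> C * (1 / (fact k * fact (N - k)))"
    if "k < N + 1" "t < S + 1" for k t
  proof -
    have k: "real n ^ k * real n ^ (N - k) = real n ^ N" "g ^ k * g ^ (N - k) = g ^ N" for n
      using that by (simp_all flip: power_add)
    have "(\<lambda>n. flip_weight S n k S t / (\<kappa> ^ n * real n ^ k) * (flip_weight S n (N - k) t 0 / (\<kappa> ^ n * real n ^ (N - k))))
      \<longlonglongrightarrow> g ^ k / real (S + 1) / fact k * (g ^ (N - k) / real (S + 1) / fact (N - k))"
      unfolding \<kappa>_def g_def using that by (intro tendsto_mult flip_weight_asymptotics) auto
    moreover have "flip_weight S n k S t / (\<kappa> ^ n * real n ^ k) * (flip_weight S n (N - k) t 0 / (\<kappa> ^ n * real n ^ (N - k)))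
      = schmidt_weight S N n k t / D n" for n
      unfolding D_def schmidt_weight_def k(1)[symmetric] by (simp add: mult_ac)
    moreover have "g ^ k / real (S + 1) / fact k * (g ^ (N - k) / real (S + 1) / fact (N - k)) = C * (1 / (fact k * fact (N - k)))"
      unfolding C_def k(2)[symmetric] by (simp add: mult_ac)
    ultimately show ?thesis by simp
  qed
  define k where "k = \<alpha> div (S + 1)"
  have k: "k < N + 1" using less_mult_imp_div_less[OF assms] by (simp add: k_def)
  have t: "\<alpha> mod (S + 1) < S + 1" by simp
  have "(\<lambda>n. \<Sum>k<N + 1. \<Sum>t<S + 1. schmidt_weight S N n k t / D n) \<longlonglongrightarrow>
      (\<Sum>k<N + 1. \<Sum>t<S + 1. C * (1 / (fact k * fact (N - k))))"
    by (intro tendsto_sum w) auto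
  also have "(\<Sum>k<N + 1. \<Sum>t<S + 1. C * (1 / (fact k * fact (N - k)))) = real (S + 1) * C * (2 ^ N / fact N)"
    unfolding sum_inverse_fact[symmetric] sum_distrib_left by (intro sum.cong refl) simp
  finally have "(\<lambda>n. (schmidt_weight S N n k (\<alpha> mod (S + 1)) / D n) / (\<Sum>k<N + 1. \<Sum>t<S + 1. schmidt_weight S N n k t / D n)) \<longlonglongrightarrow>
      C * (1 / (fact k * fact (N - k))) / (real (S + 1) * C * (2 ^ N / fact N))"
    using C by (intro tendsto_divide w k t) auto
  also have "C * (1 / (fact k * fact (N - k))) / (real (S + 1) * C * (2 ^ N / fact N)) = limit_eigenvalue S N k"
  proof -
    have "C * (1 / x) / (y * C * (p / z)) = 1 / (p * y) * (z / x)" if "x \<noteq> 0" "y \<noteq> 0" "p \<noteq> 0" "z \<noteq> 0" for x y p z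
      using that C by (simp add: divide_simps)
    from this[of "fact k * fact (N - k)" "real (S + 1)" "2 ^ N" "fact N"] show ?thesis
      using k binomial_fact[of k N, where 'a = real] by (simp add: limit_eigenvalue_def add.commute)
  qed
  finally have "(\<lambda>n. (schmidt_weight S N n k (\<alpha> mod (S + 1)) / D n) / (\<Sum>k<N + 1. \<Sum>t<S + 1. schmidt_weight S N n k t / D n))
      \<longlonglongrightarrow> limit_eigenvalue S N k" .
  moreover have "eventually (\<lambda>n. (schmidt_weight S N n k (\<alpha> mod (S + 1)) / D n) / (\<Sum>k<N + 1. \<Sum>t<S + 1. schmidt_weight S N n k t / D n)
      = tower_eigenvalue S N n \<alpha>) sequentially"
    using eventually_gt_at_top[of 0]
  proof eventually_elim
    case (elim n)
    then have "D n \<noteq> 0" using \<kappa> by (simp add: D_def)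
    then show ?case
      unfolding tower_eigenvalue_def k_def sum_divide_distrib[symmetric] by simp
  qed
  ultimately show ?thesis unfolding k_def by (rule Lim_transform_eventually)
qed

text \<open>Padding restores exactly the zeros that filtering removed, so it never has to be decided
  which Schmidt weights vanish at finite \<open>n\<close>.\<close>

lemma pad_zeros_filter_nonzero:
  assumes "size M = k"
  shows "pad_zeros k {#z \<in># M. z \<noteq> 0#} = M"
proof -
  have "{#z \<in># M. \<not> z \<noteq> 0#} = replicate_mset (count M 0) 0"
    using filter_eq_replicate_mset[of 0 M] by (simp add: eq_commute)
  then have M: "M = {#z \<in># M. z \<noteq> 0#} + replicate_mset (count M 0) 0"
    using multiset_partition[of M "\<lambda>z. z \<noteq> 0"] by simp
  from arg_cong[OF this, of size] have "k - size {#z \<in># M. z \<noteq> 0#} = count M 0"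
    using assms by simp
  with M show ?thesis unfolding pad_zeros_def by simp
qed

lemma mset_map_div:
  assumes "d > 0"
  shows "mset (map (\<lambda>\<alpha>. f (\<alpha> div d)) [0..<m * d]) = (\<Sum>k<m. replicate_mset d (f k))"
proof (induction m)
  case (Suc m)
  have "[0..<Suc m * d] = [0..<m * d] @ [m * d..<m * d + d]"
    using upt_add_eq_append[of 0 "m * d" d] by (simp add: add.commute)
  moreover have "map (\<lambda>\<alpha>. f (\<alpha> div d)) [m * d..<m * d + d] = replicate d (f m)"
  proof (rule nth_equalityI)
    fix i assume "i < length (map (\<lambda>\<alpha>. f (\<alpha> div d)) [m * d..<m * d + d])"
    then have i: "i < d" by simp
    then have "(m * d + i) div d = m" using assms by simp
    with i show "map (\<lambda>\<alpha>. f (\<alpha> div d)) [m * d..<m * d + d] ! i = replicate d (f m) ! i"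
      by simp
  qed simp
  ultimately show ?case using Suc by simp
qed simp

lemma limit_entropy_eq: "limit_entropy S N = ln (real S + 1) + binomial_entropy N"
  by (simp add: limit_entropy_def binomial_entropy_def)

text \<open>The limit spectrum is the product of the uniform law on \<open>S + 1\<close> labels and
  the binomial law of the flips, and entropy is additive on products.\<close>

lemma sum_limit_eigenvalue_entropy:
  "- (\<Sum>\<alpha><(N + 1) * (S + 1). limit_eigenvalue S N (\<alpha> div (S + 1)) * ln (limit_eigenvalue S N (\<alpha> div (S + 1)))) = limit_entropy S N"
proof -
  have s0: "(\<Sum>k\<le>N. real (N choose k) / 2 ^ N) = 1"
    using choose_row_sum[of N] unfolding sum_divide_distrib[symmetric] by (simp flip: of_nat_sum)
  have "(\<Sum>\<alpha><(N + 1) * (S + 1). limit_eigenvalue S N (\<alpha> div (S + 1)) * ln (limit_eigenvalue S N (\<alpha> div (S + 1)))) =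
      (\<Sum>k<N + 1. \<Sum>t<S + 1. limit_eigenvalue S N k * ln (limit_eigenvalue S N k))"
    using sum_div_mod[of "S + 1" "\<lambda>k t. limit_eigenvalue S N k * ln (limit_eigenvalue S N k)" "N + 1"] by simp
  also have "\<dots> = (\<Sum>k\<le>N. real (N choose k) / 2 ^ N * ln (real (N choose k) / 2 ^ N) - real (N choose k) / 2 ^ N * ln (real S + 1))"
  proof (rule sum.cong)
    fix k assume "k \<in> {..N}"
    then have pos: "0 < real (N choose k) / 2 ^ N" by simp
    have l: "limit_eigenvalue S N k = real (N choose k) / 2 ^ N / (real S + 1)" by (simp add: limit_eigenvalue_def)
    have "ln (limit_eigenvalue S N k) = ln (real (N choose k) / 2 ^ N) - ln (real S + 1)"
      unfolding l by (rule ln_divide_pos[OF pos]) simp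
    moreover have "real (S + 1) * limit_eigenvalue S N k = real (N choose k) / 2 ^ N"
      unfolding l using of_nat_Suc[of S, where 'a = real] by (simp add: add.commute)
    ultimately show "(\<Sum>t<S + 1. limit_eigenvalue S N k * ln (limit_eigenvalue S N k)) =
        real (N choose k) / 2 ^ N * ln (real (N choose k) / 2 ^ N) - real (N choose k) / 2 ^ N * ln (real S + 1)"
      by (simp only: sum_constant card_lessThan mult.assoc[symmetric] right_diff_distrib)
  qed auto
  also have "\<dots> = - binomial_entropy N - ln (real S + 1)"
    unfolding sum_subtractf sum_distrib_right[symmetric] s0 binomial_entropy_eq by simp
  finally show ?thesis by (simp add: limit_entropy_eq)
qed

theorem mainTheorem1:
  fixes S N :: nat
  assumes "S \<ge> 1"
  shows
    "((\<forall>\<^sub>F n in sequentially.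
         size (nonzero_eigenvalues (tower_rho S N n)) \<le> (S + 1) * (N + 1)) \<and>
      mset_tendsto
        (\<lambda>n. pad_zeros ((S + 1) * (N + 1)) (nonzero_eigenvalues (tower_rho S N n)))
        (\<Sum>\<alpha> = 0..N. replicate_mset (S + 1) (complex_of_real (limit_eigenvalue S N \<alpha>)))
        sequentially) \<and>
     (\<lambda>n. von_neumann_entropy (tower_rho S N n)) \<longlonglongrightarrow> complex_of_real (limit_entropy S N) \<and>
     (\<lambda>N'. limit_entropy S N' / (ln (real S + 1) + 1 / 2 * ln (pi * real N' / 2))) \<longlonglongrightarrow> 1"
proof (intro conjI)
  define r where "r = (N + 1) * (S + 1)"
  have r: "(S + 1) * (N + 1) = r" by (simp only: r_def mult.commute)
  define M where "M n = mset (map (\<lambda>\<alpha>. complex_of_real (tower_eigenvalue S N n \<alpha>)) [0..<r])" for n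
  have ev: "nonzero_eigenvalues (tower_rho S N n) = {#z \<in># M n. z \<noteq> 0#}" for n
    unfolding M_def r_def by (rule tower_rho_nonzero_eigenvalues[OF assms])
  have size: "size (M n) = r" for n by (simp add: M_def)
  have lim: "(\<lambda>n. tower_eigenvalue S N n \<alpha>) \<longlonglongrightarrow> limit_eigenvalue S N (\<alpha> div (S + 1))" if "\<alpha> < r" for \<alpha>
    using tower_eigenvalue_tendsto that by (simp only: r_def)
  show "\<forall>\<^sub>F n in sequentially. size (nonzero_eigenvalues (tower_rho S N n)) \<le> (S + 1) * (N + 1)"
  proof -
    have "size {#z \<in># M n. z \<noteq> 0#} \<le> r" for n
      using size_filter_mset_lesseq[of "\<lambda>z. z \<noteq> 0" "M n"] size[of n] by simp
    then show ?thesis unfolding r ev by simp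
  qed
  \<comment> \<open>Numbering by Schmidt indices gives lists in which each position converges, so no
    sorting of eigenvalues is involved.\<close>
  show "mset_tendsto
        (\<lambda>n. pad_zeros ((S + 1) * (N + 1)) (nonzero_eigenvalues (tower_rho S N n)))
        (\<Sum>\<alpha> = 0..N. replicate_mset (S + 1) (complex_of_real (limit_eigenvalue S N \<alpha>)))
        sequentially"
    unfolding mset_tendsto_def r ev pad_zeros_filter_nonzero[OF size]
  proof (intro exI conjI)
    have "{0..N} = {..<N + 1}" by auto
    then show "mset (map (\<lambda>\<alpha>. complex_of_real (limit_eigenvalue S N (\<alpha> div (S + 1)))) [0..<r]) =
        (\<Sum>\<alpha> = 0..N. replicate_mset (S + 1) (complex_of_real (limit_eigenvalue S N \<alpha>)))"
      unfolding r_def by (subst mset_map_div) simp_all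
    show "\<forall>\<^sub>F n in sequentially. mset (map (\<lambda>\<alpha>. complex_of_real (tower_eigenvalue S N n \<alpha>)) [0..<r]) = M n \<and>
        length (map (\<lambda>\<alpha>. complex_of_real (tower_eigenvalue S N n \<alpha>)) [0..<r]) =
        length (map (\<lambda>\<alpha>. complex_of_real (limit_eigenvalue S N (\<alpha> div (S + 1)))) [0..<r])"
      by (simp add: M_def)
    show "\<forall>i<length (map (\<lambda>\<alpha>. complex_of_real (limit_eigenvalue S N (\<alpha> div (S + 1)))) [0..<r]).
        (\<lambda>n. map (\<lambda>\<alpha>. complex_of_real (tower_eigenvalue S N n \<alpha>)) [0..<r] ! i) \<longlonglongrightarrow>
        map (\<lambda>\<alpha>. complex_of_real (limit_eigenvalue S N (\<alpha> div (S + 1)))) [0..<r] ! i"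
      using lim by (auto intro!: tendsto_of_real)
  qed
  show "(\<lambda>n. von_neumann_entropy (tower_rho S N n)) \<longlonglongrightarrow> complex_of_real (limit_entropy S N)"
  proof -
    have "von_neumann_entropy (tower_rho S N n) =
        complex_of_real (- (\<Sum>\<alpha><r. tower_eigenvalue S N n \<alpha> * ln (tower_eigenvalue S N n \<alpha>)))" for n
    proof -
      have carrier: "tower_rho S N n \<in> carrier_mat (length (configs S n)) (length (configs S n))"
        by (simp add: tower_rho_def reduced_density_def Let_def)
      have "(\<Sum>x\<in>#{#z \<in># M. z \<noteq> 0#}. Re x * ln (Re x)) = (\<Sum>x\<in>#M. Re x * ln (Re x))" for M :: "complex multiset"
        by (induction M) auto
      then have "(\<Sum>x\<in>#nonzero_eigenvalues (tower_rho S N n). Re x * ln (Re x)) = (\<Sum>x\<in>#M n. Re x * ln (Re x))"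
        unfolding ev .
      also have "\<dots> = (\<Sum>\<alpha><r. tower_eigenvalue S N n \<alpha> * ln (tower_eigenvalue S N n \<alpha>))"
        unfolding M_def by (simp add: multiset.map_comp comp_def sum_unfold_sum_mset flip: atLeast0LessThan)
      finally show ?thesis
        using von_neumann_entropy_eq_sum_nonzero_eigenvalues[OF carrier]
        by (simp add: tower_rho_def reduced_density_adjoint)
    qed
    moreover have "(\<lambda>n. - (\<Sum>\<alpha><r. tower_eigenvalue S N n \<alpha> * ln (tower_eigenvalue S N n \<alpha>))) \<longlonglongrightarrow>
        - (\<Sum>\<alpha><r. limit_eigenvalue S N (\<alpha> div (S + 1)) * ln (limit_eigenvalue S N (\<alpha> div (S + 1))))"
    proof (intro tendsto_minus tendsto_sum tendsto_mult tendsto_ln)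
      fix \<alpha> assume "\<alpha> \<in> {..<r}"
      then have a: "\<alpha> < r" by simp
      \<comment> \<open>The limit rule for \<open>ln\<close> requires a nonzero limit; the binomial
        coefficient is positive because the quotient does not exceed \<open>N\<close>.\<close>
      then have "\<alpha> div (S + 1) \<le> N" using less_mult_imp_div_less[of \<alpha> "N + 1" "S + 1"] by (simp add: r_def)
      then show "limit_eigenvalue S N (\<alpha> div (S + 1)) \<noteq> 0"
        by (simp add: limit_eigenvalue_def)
    qed (use lim in auto)
    ultimately show ?thesis
      unfolding r_def sum_limit_eigenvalue_entropy by (simp only: tendsto_of_real)
  qed
  show "(\<lambda>N'. limit_entropy S N' / (ln (real S + 1) + 1 / 2 * ln (pi * real N' / 2))) \<longlonglongrightarrow> 1"
    unfolding limit_entropy_eq by (rule binomial_entropy_asymptotics)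
qed

end
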